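(* There exists an invariant bond percolation process on the slab graph $\mathbb{Z}^2 \times \{0,1\}$ which, almost surely, has infinitely many robust clusters.
   Context: The slab $\mathbb{Z}^2\times\{0,1\}$ is the graph with vertex set $\mathbb{Z}^2\times\{0,1\}$, two vertices being adjacent iff they differ by $1$ in exactly one coordinate (so it consists of two copies of the square lattice $\mathbb{Z}^2$ joined by vertical edges between corresponding vertices). An invariant bond percolation process on a graph $G$ is a random subset of the edge set of $G$ whose distribution is invariant under all graph automorphisms of $G$. The clusters of the process are the connected components of the random subgraph formed by the retained edges. A cluster $C$ is called robust if its critical percolation probability is strictly less than $1$, i.e. there is $\epsilon>0$ such that if each edge of $C$ is deleted independently with probability $\epsilon$, then with positive probability the remaining subgraph of $C$ still has an infinite connected component. *)

theory Defs
  imports "HOL-Probability.Probability"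
begin

text \<open>Vertices of the slab Z^2 x {0,1}: the layer {0,1} is encoded by bool.\<close>
type_synonym vtx = "int \<times> int \<times> bool"

type_synonym edge = "vtx set"

definition slab_adj :: "vtx \<Rightarrow> vtx \<Rightarrow> bool" where
  "slab_adj u v = (case u of (x, y, a) \<Rightarrow> case v of (x', y', b) \<Rightarrow>
     (a = b \<and> \<bar>x - x'\<bar> + \<bar>y - y'\<bar> = 1) \<or> (a \<noteq> b \<and> x = x' \<and> y = y'))"

definition slab_edges :: "edge set" where
  "slab_edges = {{u, v} | u v. slab_adj u v}"

definition slab_aut :: "(vtx \<Rightarrow> vtx) \<Rightarrow> bool" where
  "slab_aut \<phi> \<longleftrightarrow> bij \<phi> \<and> (\<forall>u v. slab_adj u v \<longleftrightarrow> slab_adj (\<phi> u) (\<phi> v))"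

text \<open>Space of edge configurations (subsets of the edge set) with the
  product (cylinder) sigma-algebra.\<close>
definition config_space :: "edge set measure" where
  "config_space = sigma (Pow slab_edges) {{\<omega> \<in> Pow slab_edges. e \<in> \<omega>} | e. e \<in> slab_edges}"

definition invariant_bond_percolation :: "edge set measure \<Rightarrow> bool" where
  "invariant_bond_percolation P \<longleftrightarrow>
     prob_space P \<and> sets P = sets config_space \<and>
     (\<forall>\<phi>. slab_aut \<phi> \<longrightarrow> distr P config_space (\<lambda>\<omega>. (\<lambda>e. \<phi> ` e) ` \<omega>) = P)"

definition cluster_of :: "edge set \<Rightarrow> vtx \<Rightarrow> vtx set" where
  "cluster_of F v = {w. (v, w) \<in> {(a, b). {a, b} \<in> F}\<^sup>*}"

definition clusters :: "edge set \<Rightarrow> vtx set set" where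
  "clusters F = range (cluster_of F)"

definition cluster_edges :: "edge set \<Rightarrow> vtx set \<Rightarrow> edge set" where
  "cluster_edges \<omega> C = {e \<in> \<omega>. e \<subseteq> C}"

definition robust :: "edge set \<Rightarrow> vtx set \<Rightarrow> bool" where
  "robust \<omega> C \<longleftrightarrow> (\<exists>\<epsilon>::real. \<epsilon> > 0 \<and>
     (let F = cluster_edges \<omega> C;
          M = PiM F (\<lambda>_. measure_pmf (bernoulli_pmf (1 - \<epsilon>)))
      in measure M {\<eta> \<in> space M. \<exists>v. infinite (cluster_of {e \<in> F. \<eta> e} v)} > 0))"

end

theory Submission
  imports Defs
begin

text \<open>
  The slab contains two disjoint coarse copies of itself. Cut each \<open>16 x 16\<close> block of the lower layer into
  four horizontal and of the upper layer into four vertical bars; the \<open>r\<close>-th bars of both layers form a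
  cross. Calling crosses adjacent if an edge joins them, the crosses \<open>0\<close> and \<open>1\<close> of all blocks contain a
  slab, and so do the crosses \<open>2\<close> and \<open>3\<close>. Iterating gives \<open>2^n\<close> disjoint slabs of scale \<open>16^n\<close>; retain
  an edge if its ends lie in the same vertex of some coarse slab. Vertices in different coarse slabs of
  the same scale are never connected, so there are infinitely many clusters. To make the process
  invariant, every coarsening step is preceded by a uniformly random automorphism modulo \<open>16 Z^2\<close>;
  automorphisms of the slab then act on this randomness like an odometer.

  Every cluster is robust by renormalization: a cross stays connected when one of its vertices or edges
  is deleted, and adjacent crosses are joined by at least four disjoint edges. Hence a vertex or edge of
  a coarse slab can fail only if two of its boundedly many constituents do, and the failure
  probabilities at scale \<open>n\<close> decay like \<open>(C \<epsilon>)^(2^n)\<close>.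
\<close>

declare split_paired_All [simp del] split_paired_Ex [simp del]

section \<open>The slab graph and the rigidity of its automorphisms\<close>

lemma abs_sum_eq_1_iff:
  "\<bar>p::int\<bar> + \<bar>q\<bar> = 1 \<longleftrightarrow> p = 1 \<and> q = 0 \<or> p = -1 \<and> q = 0 \<or> p = 0 \<and> q = 1 \<or> p = 0 \<and> q = -1"
  by arith

lemma slab_adj_iff:
  "slab_adj (x, y, a) v \<longleftrightarrow>
     v \<in> {(x + 1, y, a), (x - 1, y, a), (x, y + 1, a), (x, y - 1, a), (x, y, \<not> a)}"
  by (cases v) (auto simp: slab_adj_def abs_sum_eq_1_iff)

lemma slab_adj_sym: "slab_adj u v \<longleftrightarrow> slab_adj v u"
  by (cases u; cases v) (auto simp: slab_adj_def abs_minus_commute)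

lemma slab_adj_irrefl [simp]: "\<not> slab_adj u u"
  by (cases u) (auto simp: slab_adj_def)

lemma slab_edge_iff: "{u, v} \<in> slab_edges \<longleftrightarrow> slab_adj u v"
  unfolding slab_edges_def mem_Collect_eq doubleton_eq_iff using slab_adj_sym by blast

lemma slab_edgeE:
  assumes "e \<in> slab_edges"
  obtains u v where "e = {u, v}" "slab_adj u v" "u \<noteq> v"
  using assms unfolding slab_edges_def using slab_adj_irrefl by blast

lemma finite_slab_adj: "finite {v. slab_adj u v}"
  by (cases u) (simp add: slab_adj_iff)

text \<open>The slab is a Cayley graph of \<open>Z^2 x Z/2\<close>; the vertex below is \<open>q + q' - p\<close> in this group.\<close>

definition parallelogram :: "vtx \<Rightarrow> vtx \<Rightarrow> vtx \<Rightarrow> vtx" where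
  "parallelogram p q q' = (case p of (x, y, a) \<Rightarrow> case q of (x1, y1, a1) \<Rightarrow> case q' of (x2, y2, a2) \<Rightarrow>
     (x1 + x2 - x, y1 + y2 - y, (a1 \<noteq> a2) \<noteq> a))"

lemma parallelogram_adj: "slab_adj q' (parallelogram p q q') \<longleftrightarrow> slab_adj p q"
  "slab_adj q (parallelogram p q q') \<longleftrightarrow> slab_adj p q'"
  by (cases p; cases q; cases q';
    simp add: parallelogram_def slab_adj_def abs_minus_commute algebra_simps; blast)+

text \<open>In \<open>Z^2 x Z/2\<close> a nonzero sum of two of the five generators determines them
  up to order. Since \<open>w\<close> is two steps from \<open>p\<close>, both via \<open>q\<close>
  and via \<open>q'\<close>, these steps are \<open>q - p\<close> and \<open>q' - p\<close>.\<close>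

lemma other_common_neighbour:
  assumes "q \<noteq> q'" "p \<noteq> w" "slab_adj p q" "slab_adj p q'" "slab_adj q w" "slab_adj q' w"
  shows "w = parallelogram p q q'"
proof -
  obtain x y a where p: "p = (x, y, a)" by (cases p)
  have q: "q = (x + 1, y, a) \<or> q = (x - 1, y, a) \<or> q = (x, y + 1, a) \<or> q = (x, y - 1, a) \<or> q = (x, y, \<not> a)"
    using assms(3) unfolding p slab_adj_iff by blast
  have q': "q' = (x + 1, y, a) \<or> q' = (x - 1, y, a) \<or> q' = (x, y + 1, a) \<or> q' = (x, y - 1, a) \<or> q' = (x, y, \<not> a)"
    using assms(4) unfolding p slab_adj_iff by blast
  show ?thesis
    using q
    by (elim disjE; use q' in \<open>elim disjE\<close>;
      use assms(1,2,5,6) in \<open>force simp: slab_adj_iff parallelogram_def p\<close>)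
qed

text \<open>The vertex \<open>p + w - q\<close> is a common neighbour of \<open>p\<close> and
  \<open>w\<close> as well, so by uniqueness it is \<open>q\<close>, and solving for
  \<open>w\<close> gives \<open>q + q - p\<close>.\<close>

lemma opposite_neighbour_unique:
  assumes "\<And>z. slab_adj p z \<and> slab_adj w z \<longleftrightarrow> z = q"
  shows "w = parallelogram p q q"
proof -
  have "slab_adj p q" "slab_adj q w" using assms[of q] slab_adj_sym by auto
  then have "slab_adj p (parallelogram q p w) \<and> slab_adj w (parallelogram q p w)"
    using parallelogram_adj slab_adj_sym by blast
  then have "parallelogram q p w = q" using assms by blast
  then show ?thesis
    by (cases p; cases q; cases w) (auto simp: parallelogram_def)
qed

lemma slab_aut_adj: "slab_aut \<phi> \<Longrightarrow> slab_adj (\<phi> u) (\<phi> v) \<longleftrightarrow> slab_adj u v"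
  unfolding slab_aut_def by blast

lemma slab_aut_bij: "slab_aut \<phi> \<Longrightarrow> bij \<phi>"
  by (simp add: slab_aut_def)

lemma slab_aut_eq: "slab_aut \<phi> \<Longrightarrow> \<phi> u = \<phi> v \<longleftrightarrow> u = v"
  by (metis slab_aut_bij bij_def injD)

lemma slab_aut_comp: "slab_aut \<phi> \<Longrightarrow> slab_aut \<psi> \<Longrightarrow> slab_aut (\<phi> \<circ> \<psi>)"
  by (simp add: slab_aut_def bij_comp)

lemma slab_aut_inv:
  assumes "slab_aut \<phi>" shows "slab_aut (inv \<phi>)"
proof -
  have "bij \<phi>" using assms slab_aut_bij by blast
  then have "slab_adj (inv \<phi> u) (inv \<phi> v) = slab_adj u v" for u v
    using slab_aut_adj[OF assms, of "inv \<phi> u" "inv \<phi> v"] by (simp add: bij_is_surj surj_f_inv_f)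
  then show ?thesis unfolding slab_aut_def using \<open>bij \<phi>\<close> bij_imp_bij_inv by blast
qed

lemma slab_aut_edge: "slab_aut \<phi> \<Longrightarrow> \<phi> ` e \<in> slab_edges \<longleftrightarrow> e \<in> slab_edges"
proof -
  have imp: "\<phi> ` e \<in> slab_edges" if "e \<in> slab_edges" "slab_aut \<phi>" for e \<phi>
    using that by (elim slab_edgeE) (auto simp: slab_edge_iff slab_aut_adj)
  assume \<phi>: "slab_aut \<phi>"
  have "inv \<phi> ` \<phi> ` e = e"
    using slab_aut_bij[OF \<phi>] by (simp add: bij_is_inj)
  then show ?thesis using imp \<phi> slab_aut_inv by metis
qed

text \<open>Automorphisms preserve common neighbours. Either \<open>u\<close> and \<open>w\<close>
  have a second common neighbour besides \<open>v\<close>, or \<open>v\<close> is the only one; in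
  both cases a \<open>parallelogram\<close> formula computes the image of \<open>w\<close> from
  images that are known to agree.\<close>

lemma slab_aut_agree_step:
  assumes \<phi>: "slab_aut \<phi>" and \<psi>: "slab_aut \<psi>"
    and "\<phi> u = \<psi> u" and agree: "\<And>z. slab_adj u z \<Longrightarrow> \<phi> z = \<psi> z"
    and "slab_adj u v" and "slab_adj v w"
  shows "\<phi> w = \<psi> w"
proof (cases "w = u")
  case False
  show ?thesis
  proof (cases "\<exists>v'. v' \<noteq> v \<and> slab_adj u v' \<and> slab_adj w v'")
    case True
    then obtain v' where v': "v' \<noteq> v" "slab_adj u v'" "slab_adj w v'" by blast
    have eqs: "\<phi> v' = \<psi> v'" "\<phi> v = \<psi> v" using agree v' assms(5) by auto
    have "slab_adj v' w" using v' slab_adj_sym by blast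
    have "slab_adj (\<theta> u) (\<theta> v)" "slab_adj (\<theta> u) (\<theta> v')"
      "slab_adj (\<theta> v) (\<theta> w)" "slab_adj (\<theta> v') (\<theta> w)" if "slab_aut \<theta>" for \<theta>
      using that assms(5,6) v' \<open>slab_adj v' w\<close> by (simp_all add: slab_aut_adj)
    note this[OF \<phi>] this[OF \<psi>]
    moreover note eqs
    moreover have "\<phi> v \<noteq> \<phi> v'" "\<phi> u \<noteq> \<phi> w" "\<phi> u \<noteq> \<psi> w"
      using v' False assms(3) slab_aut_eq[OF \<phi>, of v v'] slab_aut_eq[OF \<phi>, of u w]
        slab_aut_eq[OF \<psi>, of u w] by auto
    ultimately show ?thesis
      using other_common_neighbour by metis
  next
    case noother: False
    have "slab_adj (\<theta> u) z \<and> slab_adj (\<theta> w) z \<longleftrightarrow> z = \<theta> v" if aut: "slab_aut \<theta>" for \<theta> z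
    proof -
      obtain z' where "z = \<theta> z'" using slab_aut_bij[OF aut] by (metis bij_pointE)
      then show ?thesis using noother assms(5,6) aut
        by (metis slab_aut_adj slab_aut_eq slab_adj_sym)
    qed
    from this[OF \<phi>] this[OF \<psi>] show ?thesis
      using opposite_neighbour_unique[of "\<phi> u" "\<phi> w" "\<phi> v"]
        opposite_neighbour_unique[of "\<psi> u" "\<psi> w" "\<psi> v"] assms by auto
  qed
qed (use assms in auto)

lemma slab_connected: "((0, 0, False), u) \<in> {(p, q). slab_adj p q}\<^sup>*"
proof -
  let ?R = "{(p, q). slab_adj p q}\<^sup>*"
  obtain x y b where u: "u = (x, y, b)" by (cases u)
  have 1: "((0, 0, False), (x, 0, False)) \<in> ?R"
    by (induction x rule: int_induct[where k = 0])
      (auto simp: slab_adj_iff intro: rtrancl_into_rtrancl)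
  have 2: "((x, 0, False), (x, y, False)) \<in> ?R"
    by (induction y rule: int_induct[where k = 0])
      (auto simp: slab_adj_iff intro: rtrancl_into_rtrancl)
  have 3: "((x, y, False), (x, y, b)) \<in> ?R"
    by (cases b) (auto simp: slab_adj_iff)
  show ?thesis unfolding u using 1 2 3 by (meson rtrancl_trans)
qed

lemma slab_aut_rigid:
  assumes \<phi>: "slab_aut \<phi>" and \<psi>: "slab_aut \<psi>"
    and "\<phi> (0, 0, False) = \<psi> (0, 0, False)"
    and "\<And>z. slab_adj (0, 0, False) z \<Longrightarrow> \<phi> z = \<psi> z"
  shows "\<phi> = \<psi>"
proof
  fix u
  \<comment> \<open>The one-step lemma needs agreement at a vertex and at all its neighbours, so
    this is the invariant carried along a path from the origin.\<close>
  have "\<phi> u = \<psi> u \<and> (\<forall>z. slab_adj u z \<longrightarrow> \<phi> z = \<psi> z)"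
    using slab_connected[of u]
  proof induction
    case (step p q)
    then have "slab_adj p q" by simp
    then show ?case using slab_aut_agree_step[OF \<phi> \<psi>, of p q] step.IH by blast
  qed (use assms in auto)
  then show "\<phi> u = \<psi> u" ..
qed

section \<open>Automorphisms modulo translations by multiples of 16\<close>

definition fundamental_box :: "vtx set" where
  "fundamental_box = {0..<16} \<times> {0..<16} \<times> UNIV"

text \<open>One automorphism from each class modulo left composition with translations by
  \<open>16 Z^2\<close>: exactly one such translation moves the image of the origin into the
  box.\<close>

definition aut_reps :: "(vtx \<Rightarrow> vtx) set" where
  "aut_reps = {\<phi>. slab_aut \<phi> \<and> \<phi> (0, 0, False) \<in> fundamental_box}"

lemma finite_fundamental_box: "finite fundamental_box"
  by (simp add: fundamental_box_def)

text \<open>By rigidity, restriction to the origin and its neighbours is injective, and these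
  vertices go into the box or next to it.\<close>

lemma finite_aut_reps: "finite aut_reps"
proof -
  let ?o = "(0, 0, False)"
  let ?D = "insert ?o {z. slab_adj ?o z}"
  let ?B = "fundamental_box \<union> (\<Union>u\<in>fundamental_box. {z. slab_adj u z})"
  have "finite (Pi\<^sub>E ?D (\<lambda>_. ?B))"
    by (intro finite_PiE) (auto simp: finite_slab_adj finite_fundamental_box)
  moreover have "restrict \<phi> ?D \<in> Pi\<^sub>E ?D (\<lambda>_. ?B)" if "\<phi> \<in> aut_reps" for \<phi>
  proof (intro restrict_PiE_iff[THEN iffD2] ballI)
    fix z assume "z \<in> ?D"
    then have "\<phi> z = \<phi> ?o \<or> slab_adj (\<phi> ?o) (\<phi> z)"
      using that unfolding aut_reps_def using slab_aut_adj by blast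
    moreover have "\<phi> ?o \<in> fundamental_box" using that by (simp add: aut_reps_def)
    ultimately show "\<phi> z \<in> ?B" by (metis UnI1 UnI2 UN_I mem_Collect_eq)
  qed
  then have "(\<lambda>\<phi>. restrict \<phi> ?D) ` aut_reps \<subseteq> Pi\<^sub>E ?D (\<lambda>_. ?B)" by blast
  moreover have "inj_on (\<lambda>\<phi>. restrict \<phi> ?D) aut_reps"
  proof (rule inj_onI)
    fix \<phi> \<psi> assume *: "\<phi> \<in> aut_reps" "\<psi> \<in> aut_reps" "restrict \<phi> ?D = restrict \<psi> ?D"
    then have "\<phi> z = \<psi> z" if "z \<in> ?D" for z
      using that by (metis restrict_apply')
    then show "\<phi> = \<psi>" using * by (intro slab_aut_rigid) (auto simp: aut_reps_def)
  qed
  ultimately show ?thesis by (meson finite_imageD finite_subset)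
qed

section \<open>Coarse-graining\<close>

definition translate :: "int \<times> int \<Rightarrow> vtx \<Rightarrow> vtx" where
  "translate t u = (case t of (p, q) \<Rightarrow> case u of (x, y, b) \<Rightarrow> (x + p, y + q, b))"

text \<open>In the cross \<open>r\<close> of a block, \<open>2 \<le> r\<close> selects the coarse slab and the parity of \<open>r\<close> is the layer in it.\<close>

definition coarse :: "vtx \<Rightarrow> bool \<times> vtx" where
  "coarse u = (case u of (x, y, b) \<Rightarrow>
     let r = (if b then x else y) mod 16 div 4 in (2 \<le> r, x div 16, y div 16, odd r))"

text \<open>The offset \<open>4 * r\<close> of the bar \<open>r = 2 * s + a\<close> in its block,
  with \<open>s\<close> and \<open>a\<close> read as 0 or 1.\<close>

definition bar :: "bool \<Rightarrow> bool \<Rightarrow> int" where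
  "bar s a = (if s then 8 else 0) + (if a then 4 else 0)"

text \<open>Turns membership in a cross into linear inequalities, so that the geometry of crosses
  becomes arithmetic.\<close>

lemma coarse_iff:
  "coarse (x, y, b) = (s, X, Y, a) \<longleftrightarrow>
     16 * X \<le> x \<and> x < 16 * X + 16 \<and> 16 * Y \<le> y \<and> y < 16 * Y + 16 \<and>
     (if b then 16 * X + bar s a \<le> x \<and> x < 16 * X + bar s a + 4
      else 16 * Y + bar s a \<le> y \<and> y < 16 * Y + bar s a + 4)"
proof -
  \<comment> \<open>The one-dimensional statement for the coordinate across the bar, which is
    \<open>x\<close> in the upper and \<open>y\<close> in the lower layer.\<close>
  have key: "(2 \<le> z mod 16 div 4 \<longleftrightarrow> s) \<and> z div 16 = Z \<and> (odd (z mod 16 div 4) \<longleftrightarrow> a) \<longleftrightarrow>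
     16 * Z + bar s a \<le> z \<and> z < 16 * Z + bar s a + 4" for z Z :: int
  proof -
    define m where "m = z mod 16"
    define d where "d = z div 16"
    define q where "q = m div 4"
    have m: "0 \<le> m" "m < 16" and z: "z = 16 * d + m" by (auto simp: m_def d_def)
    have q: "4 * q \<le> m" "m < 4 * q + 4" unfolding q_def by presburger+
    have q4: "q = 0 \<or> q = 1 \<or> q = 2 \<or> q = 3" using m q by linarith
    have "2 \<le> q \<longleftrightarrow> 8 \<le> m" "odd q \<longleftrightarrow> 4 \<le> m \<and> m < 8 \<or> 12 \<le> m"
      using q4 q m by auto
    then have "(2 \<le> q \<longleftrightarrow> s) \<and> (odd q \<longleftrightarrow> a) \<longleftrightarrow> bar s a \<le> m \<and> m < bar s a + 4"
      using m by (cases s; cases a) (auto simp: bar_def)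
    moreover have "d = Z \<and> c \<le> m \<and> m < c + 4 \<longleftrightarrow> 16 * Z + c \<le> z \<and> z < 16 * Z + c + 4"
      if "0 \<le> c" "c \<le> 12" for c
    proof -
      have "d = Z" if "16 * Z + c \<le> z" "z < 16 * Z + c + 4"
      proof -
        have "d < Z + 1" "Z < d + 1" using that m z \<open>0 \<le> c\<close> \<open>c \<le> 12\<close> by linarith+
        then show ?thesis by linarith
      qed
      then show ?thesis using z by auto
    qed
    moreover have "0 \<le> bar s a" "bar s a \<le> 12" by (auto simp: bar_def)
    ultimately show ?thesis
      unfolding m_def[symmetric] q_def[symmetric] d_def[symmetric] by blast
  qed
  have dv: "z div 16 = Z \<longleftrightarrow> 16 * Z \<le> z \<and> z < 16 * Z + 16" for z Z :: int by presburger
  have bb: "0 \<le> bar s a" "bar s a \<le> 12" by (auto simp: bar_def)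
  show ?thesis
  proof (cases b)
    case True
    have "coarse (x, y, b) = (s, X, Y, a) \<longleftrightarrow>
        ((2 \<le> x mod 16 div 4 \<longleftrightarrow> s) \<and> x div 16 = X \<and> (odd (x mod 16 div 4) \<longleftrightarrow> a)) \<and> y div 16 = Y"
      unfolding coarse_def Let_def prod.case prod.inject by (simp only: True if_True) blast
    then show ?thesis unfolding key unfolding dv using bb True by auto
  next
    case False
    have "coarse (x, y, b) = (s, X, Y, a) \<longleftrightarrow>
        ((2 \<le> y mod 16 div 4 \<longleftrightarrow> s) \<and> y div 16 = Y \<and> (odd (y mod 16 div 4) \<longleftrightarrow> a)) \<and> x div 16 = X"
      unfolding coarse_def Let_def prod.case prod.inject by (simp only: False if_False) blast
    then show ?thesis unfolding key unfolding dv using bb False by auto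
  qed
qed

text \<open>The pattern of crosses has period 16 in both directions. This is what makes translations
  carry over to the next scale.\<close>

lemma coarse_translate:
  "coarse (translate (16 * p, 16 * q) u) = (fst (coarse u), translate (p, q) (snd (coarse u)))"
  by (cases u) (auto simp: coarse_def translate_def Let_def)

lemma translate_translate: "translate (p, q) (translate (p', q') u) = translate (p + p', q + q') u"
  by (cases u) (auto simp: translate_def)

lemma translate_0: "translate (0, 0) u = u"
  by (cases u) (auto simp: translate_def)

lemma translate_aut: "slab_aut (translate t)"
proof (cases t)
  case (Pair p q)
  have "bij (translate (p, q))"
    by (rule o_bij[of "translate (-p, -q)"]) (auto simp: fun_eq_iff translate_translate translate_0)
  moreover have "slab_adj u v \<longleftrightarrow> slab_adj (translate (p, q) u) (translate (p, q) v)" for u v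
    by (cases u; cases v) (simp add: slab_adj_def translate_def)
  ultimately show ?thesis by (simp add: slab_aut_def Pair)
qed

lemma coarse_surj: "\<exists>u. coarse u = sv"
proof -
  obtain s X Y a where "sv = (s, X, Y, a)" by (cases sv)
  then have "coarse (16 * X, 16 * Y + bar s a, False) = sv"
    by (auto simp: coarse_iff bar_def)
  then show ?thesis ..
qed

text \<open>A cross lies in the two layers of one block, which have \<open>16 * 16 * 2 = 512\<close>
  vertices.\<close>

lemma card_coarse_fibre: "finite {u. coarse u = sv}" "card {u. coarse u = sv} \<le> 512"
proof -
  obtain s X Y a where sv: "sv = (s, X, Y, a)" by (cases sv)
  have sub: "{u. coarse u = sv} \<subseteq> {16*X..<16*X+16} \<times> {16*Y..<16*Y+16} \<times> UNIV"
    unfolding sv by (auto simp: coarse_iff)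
  then show "finite {u. coarse u = sv}"
    by (rule finite_subset) simp
  have "card {u. coarse u = sv} \<le> card ({16*X..<16*X+16} \<times> {16*Y..<16*Y+16} \<times> (UNIV :: bool set))"
    by (rule card_mono[OF _ sub]) simp
  then show "card {u. coarse u = sv} \<le> 512" by (simp add: card_cartesian_product)
qed

section \<open>Connectivity of a cross with one defect\<close>

text \<open>Vertices appear as singletons, so that one predicate on vertex sets can mark failures of
  vertices and of edges alike.\<close>

definition atoms :: "vtx set set" where
  "atoms = range (\<lambda>u. {u}) \<union> slab_edges"

lemma singleton_atom [simp]: "{u} \<in> atoms" by (simp add: atoms_def)

lemma edge_atom: "slab_adj u v \<Longrightarrow> {u, v} \<in> atoms" by (simp add: atoms_def slab_edge_iff)

lemma atomE:
  assumes "c \<in> atoms"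
  obtains u where "c = {u}" | u v where "c = {u, v}" "slab_adj u v" "u \<noteq> v"
proof (cases "c \<in> slab_edges")
  case True
  then show ?thesis using slab_edgeE that(2) by metis
next
  case False
  then show ?thesis using assms that(1) by (auto simp: atoms_def)
qed

text \<open>In this section \<open>bad\<close> is a variable for an arbitrary set of failed atoms.
  Later it becomes failure one level below, pulled back by the automorphism of that level.\<close>

definition good_steps :: "(vtx set \<Rightarrow> bool) \<Rightarrow> vtx set \<Rightarrow> (vtx \<times> vtx) set" where
  "good_steps bad R = {(p, q). p \<in> R \<and> q \<in> R \<and> slab_adj p q \<and> \<not> bad {p} \<and> \<not> bad {q} \<and> \<not> bad {p, q}}"

definition one_defect :: "(vtx set \<Rightarrow> bool) \<Rightarrow> vtx set \<Rightarrow> bool" where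
  "one_defect bad R \<longleftrightarrow>
     (\<forall>c\<in>atoms. \<forall>c'\<in>atoms. c \<subseteq> R \<longrightarrow> c' \<subseteq> R \<longrightarrow> bad c \<longrightarrow> bad c' \<longrightarrow> c = c')"

definition clean :: "(vtx set \<Rightarrow> bool) \<Rightarrow> vtx set \<Rightarrow> bool" where
  "clean bad R \<longleftrightarrow> (\<forall>c\<in>atoms. c \<subseteq> R \<longrightarrow> \<not> bad c)"

lemma good_steps_mono: "R \<subseteq> R' \<Longrightarrow> (good_steps bad R)\<^sup>* \<subseteq> (good_steps bad R')\<^sup>*"
  by (rule rtrancl_mono) (auto simp: good_steps_def)

lemma sym_good_steps: "sym ((good_steps bad R)\<^sup>*)"
  by (rule sym_rtrancl) (auto simp: good_steps_def sym_def insert_commute slab_adj_sym)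

lemma one_defect_mono: "one_defect bad R' \<Longrightarrow> R \<subseteq> R' \<Longrightarrow> one_defect bad R"
  unfolding one_defect_def by blast

lemma one_defectD:
  "one_defect bad R \<Longrightarrow> bad {p} \<Longrightarrow> bad {q} \<Longrightarrow> p \<in> R \<Longrightarrow> q \<in> R \<Longrightarrow> p = q"
  unfolding one_defect_def
  by (drule bspec[of _ _ "{p}"], simp, drule bspec[of _ _ "{q}"]) auto

lemma clean_path:
  fixes f :: "int \<Rightarrow> vtx"
  assumes adj: "\<And>i. slab_adj (f i) (f (i + 1))" and clean: "clean bad (f ` {m..n})"
    and "i \<in> {m..n}" "j \<in> {m..n}"
  shows "(f i, f j) \<in> (good_steps bad (f ` {m..n}))\<^sup>*"
proof -
  let ?S = "good_steps bad (f ` {m..n})"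
  have *: "(f i, f j) \<in> ?S\<^sup>*" if "i \<le> j" "m \<le> i" "j \<le> n" for i j
    using that
  proof (induction j rule: int_ge_induct)
    case (step j)
    have "(f j, f (j + 1)) \<in> ?S"
      using clean step adj edge_atom[OF adj] by (auto simp: good_steps_def clean_def)
    then show ?case using step by (auto intro: rtrancl_into_rtrancl)
  qed simp
  show ?thesis
    using *[of i j] *[of j i] assms(3,4) symD[OF sym_good_steps] by (cases "i \<le> j") auto
qed

text \<open>The two extreme rows are disjoint, and so are the two extreme columns, so a single
  defect leaves a clean row and a clean column. Every good vertex reaches their crossing: its own
  row and column share only the vertex itself, so one of them is clean.\<close>

lemma rectangle_connected:
  fixes x0 x1 y0 y1 :: int and b :: bool
  assumes "x0 < x1" "y0 < y1"
  defines "R \<equiv> {x0..x1} \<times> {y0..y1} \<times> {b}"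
  assumes defect: "one_defect bad R"
    and u: "u \<in> R" "\<not> bad {u}" and v: "v \<in> R" "\<not> bad {v}"
  shows "(u, v) \<in> (good_steps bad R)\<^sup>*"
proof -
  let ?S = "(good_steps bad R)\<^sup>*"
  define row where "row y = (\<lambda>x. (x, y, b)) ` {x0..x1}" for y :: int
  define col where "col x = (\<lambda>y. (x, y, b)) ` {y0..y1}" for x :: int
  have row_sub: "row y \<subseteq> R" if "y \<in> {y0..y1}" for y using that by (auto simp: row_def R_def)
  have col_sub: "col x \<subseteq> R" if "x \<in> {x0..x1}" for x using that by (auto simp: col_def R_def)
  have row_path: "((x, y, b), (x', y, b)) \<in> ?S"
    if "clean bad (row y)" "x \<in> {x0..x1}" "x' \<in> {x0..x1}" "y \<in> {y0..y1}" for x x' y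
    using clean_path[of "\<lambda>x. (x, y, b)" bad x0 x1 x x'] that good_steps_mono[OF row_sub[of y]]
    by (auto simp: row_def slab_adj_iff)
  have col_path: "((x, y, b), (x, y', b)) \<in> ?S"
    if "clean bad (col x)" "y \<in> {y0..y1}" "y' \<in> {y0..y1}" "x \<in> {x0..x1}" for x y y'
    using clean_path[of "\<lambda>y. (x, y, b)" bad y0 y1 y y'] that good_steps_mono[OF col_sub[of x]]
    by (auto simp: col_def slab_adj_iff)
  have same: "c = c'" if "c \<in> atoms" "c' \<in> atoms" "c \<subseteq> R" "c' \<subseteq> R" "bad c" "bad c'" for c c'
    using defect that unfolding one_defect_def by blast
  have nonempty: "c \<noteq> {}" if "c \<in> atoms" for c using that by (auto elim: atomE)
  have "clean bad (row y0) \<or> clean bad (row y1)"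
  proof (rule ccontr)
    assume "\<not> ?thesis"
    then obtain c c' where c: "c \<in> atoms" "c \<subseteq> row y0" "bad c" "c' \<in> atoms" "c' \<subseteq> row y1" "bad c'"
      unfolding clean_def by blast
    then have "c = c'" using same[of c c'] row_sub[of y0] row_sub[of y1] assms(1,2) by (meson atLeastAtMost_iff less_imp_le order_refl subset_trans)
    then show False using c nonempty[of c] assms(2) unfolding row_def by fastforce
  qed
  then obtain ys where ys: "ys \<in> {y0..y1}" "clean bad (row ys)" using assms(2) by (metis atLeastAtMost_iff less_imp_le order_refl)
  have "clean bad (col x0) \<or> clean bad (col x1)"
  proof (rule ccontr)
    assume "\<not> ?thesis"
    then obtain c c' where c: "c \<in> atoms" "c \<subseteq> col x0" "bad c" "c' \<in> atoms" "c' \<subseteq> col x1" "bad c'"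
      unfolding clean_def by blast
    then have "c = c'" using same[of c c'] col_sub[of x0] col_sub[of x1] assms(1,2) by (meson atLeastAtMost_iff less_imp_le order_refl subset_trans)
    then show False using c nonempty[of c] assms(1) unfolding col_def by fastforce
  qed
  then obtain xs where xs: "xs \<in> {x0..x1}" "clean bad (col xs)" using assms(1) by (metis atLeastAtMost_iff less_imp_le order_refl)
  have hub: "(z, (xs, ys, b)) \<in> ?S" if zR: "z \<in> R" and zb: "\<not> bad {z}" for z
  proof -
    obtain x y where z: "z = (x, y, b)" "x \<in> {x0..x1}" "y \<in> {y0..y1}"
      using zR by (auto simp: R_def)
    have "clean bad (col x) \<or> clean bad (row y)"
    proof (rule ccontr)
      assume "\<not> ?thesis"
      then obtain c c' where c: "c \<in> atoms" "c \<subseteq> col x" "bad c" "c' \<in> atoms" "c' \<subseteq> row y" "bad c'"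
        unfolding clean_def by blast
      then have "c = c'" using same[of c c'] col_sub[of x] row_sub[of y] z by blast
      then have "c \<subseteq> {z}" using c z by (auto simp: row_def col_def)
      then have "c = {z}" using nonempty c by blast
      then show False using zb c by simp
    qed
    then show ?thesis
    proof
      assume "clean bad (col x)"
      then show ?thesis
        using col_path[of x y ys] row_path[of ys x xs] z xs ys by (auto intro: rtrancl_trans)
    next
      assume "clean bad (row y)"
      then show ?thesis
        using row_path[of y x xs] col_path[of xs y ys] z xs ys by (auto intro: rtrancl_trans)
    qed
  qed
  show ?thesis using hub[OF u] hub[OF v] symD[OF sym_good_steps] rtrancl_trans by metis
qed

text \<open>The cross consists of a horizontal bar below and a vertical bar above. Each remains
  connected as a rectangle, and the defect cannot destroy all vertical edges between them.\<close>

lemma coarse_fibre_connected: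
  assumes defect: "one_defect bad {u. coarse u = sv}" (is "one_defect bad ?R")
    and u: "coarse u = sv" "\<not> bad {u}" and v: "coarse v = sv" "\<not> bad {v}"
  shows "(u, v) \<in> (good_steps bad ?R)\<^sup>*"
proof -
  obtain s X Y a where sv: "sv = (s, X, Y, a)" by (cases sv)
  let ?S = "(good_steps bad ?R)\<^sup>*"
  let ?r = "bar s a"
  have bb: "0 \<le> ?r" "?r \<le> 12" by (auto simp: bar_def)
  define H where "H = {16*X..16*X+15} \<times> {16*Y+?r..16*Y+?r+3} \<times> {False}"
  define V where "V = {16*X+?r..16*X+?r+3} \<times> {16*Y..16*Y+15} \<times> {True}"
  have R: "?R = H \<union> V"
    using bb by (auto simp: sv coarse_iff H_def V_def split: if_splits)
  have H: "(p, q) \<in> ?S" if "p \<in> H" "\<not> bad {p}" "q \<in> H" "\<not> bad {q}" for p q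
    using rectangle_connected[of "16*X" "16*X+15" "16*Y+?r" "16*Y+?r+3" bad False p q]
      one_defect_mono[OF defect, of H] good_steps_mono[of H ?R bad] that R
    unfolding H_def[symmetric] by auto
  have V: "(p, q) \<in> ?S" if "p \<in> V" "\<not> bad {p}" "q \<in> V" "\<not> bad {q}" for p q
    using rectangle_connected[of "16*X+?r" "16*X+?r+3" "16*Y" "16*Y+15" bad True p q]
      one_defect_mono[OF defect, of V] good_steps_mono[of V ?R bad] that R
    unfolding V_def[symmetric] by auto
  \<comment> \<open>For \<open>i = 0\<close> and \<open>i = 1\<close> these are the ends of two
    disjoint vertical edges in the 4 by 4 square where the bars overlap; one of them survives a
    single defect.\<close>
  define h where "h i = (16*X+?r+i, 16*Y+?r, False)" for i :: int
  define w where "w i = (16*X+?r+i, 16*Y+?r, True)" for i :: int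
  have hw: "h 0 \<in> H" "h 1 \<in> H" "w 0 \<in> V" "w 1 \<in> V"
    using bb by (auto simp: h_def w_def H_def V_def)
  have adj: "slab_adj (h i) (w i)" for i by (simp add: h_def w_def slab_adj_iff)
  have "\<exists>i\<in>{0,1}. \<not> bad {h i} \<and> \<not> bad {w i} \<and> \<not> bad {h i, w i}"
  proof (rule ccontr)
    assume "\<not> ?thesis"
    then have *: "bad {h i} \<or> bad {w i} \<or> bad {h i, w i}" if "i \<in> {0,1}" for i using that by blast
    have "\<exists>c\<in>atoms. c \<subseteq> {h i, w i} \<and> bad c" if "i \<in> {0,1}" for i
      using *[OF that] edge_atom[OF adj[of i]] singleton_atom[of "h i"] singleton_atom[of "w i"]
      by (metis insertI1 insertI2 empty_subsetI insert_subset order_refl)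
    from this[of 0] this[of 1]
    obtain c c' where c: "c \<in> atoms" "c \<subseteq> {h 0, w 0}" "bad c" "c' \<in> atoms" "c' \<subseteq> {h 1, w 1}" "bad c'"
      by auto
    then have "c = c'" using defect hw R unfolding one_defect_def by blast
    moreover have "c \<noteq> {}" using c by (auto elim: atomE)
    ultimately show False using c by (auto simp: h_def w_def)
  qed
  then obtain i where i: "i \<in> {0, 1}" "\<not> bad {h i}" "\<not> bad {w i}" "\<not> bad {h i, w i}" by blast
  then have i': "h i \<in> H" "w i \<in> V" using hw by auto
  then have "(h i, w i) \<in> good_steps bad ?R" using i adj R by (auto simp: good_steps_def)
  then have hw': "(h i, w i) \<in> ?S" by blast
  have hub: "(z, h i) \<in> ?S" if "coarse z = sv" "\<not> bad {z}" for z
  proof (cases "z \<in> H")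
    case True
    then show ?thesis using H i i' that by blast
  next
    case False
    then have "z \<in> V" using that R by blast
    then have "(z, w i) \<in> ?S" using V i i' that by blast
    then show ?thesis using hw' symD[OF sym_good_steps] rtrancl_trans by metis
  qed
  show ?thesis using hub[OF u] hub[OF v] symD[OF sym_good_steps] rtrancl_trans by metis
qed

text \<open>Bars are 4 wide. Lower bars of blocks adjacent in direction \<open>x\<close> meet end to
  end along 4 edges, and so do upper bars in direction \<open>y\<close>. For the two layers of a
  coarse slab, the lower bar of one cross overlaps the upper bar of the other in a 4 by 4 square,
  one row of which gives the links.\<close>

lemma coarse_adjacent_links:
  assumes "slab_adj v v'"
  obtains f g :: "nat \<Rightarrow> vtx"
  where "\<And>i. i < 4 \<Longrightarrow> coarse (f i) = (s, v) \<and> coarse (g i) = (s, v') \<and> slab_adj (f i) (g i)"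
    "inj f" "inj g"
proof -
  have *: "\<exists>f g :: nat \<Rightarrow> vtx. (\<forall>i<4. coarse (f i) = (s, v) \<and> coarse (g i) = (s, v') \<and> slab_adj (f i) (g i))
      \<and> inj f \<and> inj g"
    if v': "v' \<in> {(x + 1, y, a), (x, y + 1, a), (x, y, True)}" "a \<longrightarrow> v' \<noteq> (x, y, True)" and v: "v = (x, y, a)"
    for v v' x y a
  proof -
    consider "v' = (x + 1, y, a)" | "v' = (x, y + 1, a)" | "v' = (x, y, True)" "\<not> a" using v' by fastforce
    then show ?thesis
    proof cases
      case 1
      then show ?thesis
        by (intro exI[of _ "\<lambda>i. (16*x+15, 16*y + bar s a + int i, False)"]
            exI[of _ "\<lambda>i. (16*x+16, 16*y + bar s a + int i, False)"])
          (auto simp: v coarse_iff slab_adj_iff bar_def inj_def)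
    next
      case 2
      then show ?thesis
        by (intro exI[of _ "\<lambda>i. (16*x + bar s a + int i, 16*y+15, True)"]
            exI[of _ "\<lambda>i. (16*x + bar s a + int i, 16*y+16, True)"])
          (auto simp: v coarse_iff slab_adj_iff bar_def inj_def)
    next
      case 3
      then show ?thesis
        by (intro exI[of _ "\<lambda>i. (16*x + bar s True + int i, 16*y + bar s False, False)"]
            exI[of _ "\<lambda>i. (16*x + bar s True + int i, 16*y + bar s False, True)"])
          (auto simp: v coarse_iff slab_adj_iff bar_def inj_def)
    qed
  qed
  obtain x y a where v: "v = (x, y, a)" by (cases v)
  obtain x' y' a' where v': "v' = (x', y', a')" by (cases v')
  \<comment> \<open>Up to exchanging \<open>v\<close> and \<open>v'\<close>, the coarse edge points
    in a positive direction or from the lower to the upper layer.\<close>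
  have "(v' \<in> {(x + 1, y, a), (x, y + 1, a), (x, y, True)} \<and> (a \<longrightarrow> v' \<noteq> (x, y, True))) \<or>
        (v \<in> {(x' + 1, y', a'), (x', y' + 1, a'), (x', y', True)} \<and> (a' \<longrightarrow> v \<noteq> (x', y', True)))"
    using assms unfolding v slab_adj_iff unfolding v' by auto
  then show ?thesis
  proof (elim disjE conjE)
    assume "v' \<in> {(x + 1, y, a), (x, y + 1, a), (x, y, True)}" "a \<longrightarrow> v' \<noteq> (x, y, True)"
    from *[OF this v] show ?thesis using that by blast
  next
    assume "v \<in> {(x' + 1, y', a'), (x', y' + 1, a'), (x', y', True)}" "a' \<longrightarrow> v \<noteq> (x', y', True)"
    from *[OF this v'] obtain f g :: "nat \<Rightarrow> vtx" where
      "\<forall>i<4. coarse (f i) = (s, v') \<and> coarse (g i) = (s, v) \<and> slab_adj (f i) (g i)" "inj f" "inj g"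
      by blast
    then show ?thesis using that[of g f] slab_adj_sym by blast
  qed
qed

text \<open>Among the four links, at most one has a bad first end, at most one a bad second end, and
  at most one is itself bad. Four exceeds three, so one link is intact.\<close>

lemma good_link:
  assumes adj: "slab_adj v v'"
    and v: "one_defect bad {u. coarse u = (s, v)}" and v': "one_defect bad {u. coarse u = (s, v')}"
    and links: "\<And>c c'. c \<in> slab_edges \<Longrightarrow> c' \<in> slab_edges \<Longrightarrow> coarse ` c = {(s, v), (s, v')} \<Longrightarrow>
      coarse ` c' = {(s, v), (s, v')} \<Longrightarrow> bad c \<Longrightarrow> bad c' \<Longrightarrow> c = c'"
  obtains u u' where "coarse u = (s, v)" "coarse u' = (s, v')" "slab_adj u u'"
    "\<not> bad {u}" "\<not> bad {u'}" "\<not> bad {u, u'}"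
proof -
  obtain f g :: "nat \<Rightarrow> vtx" where fg: "\<And>i. i < 4 \<Longrightarrow> coarse (f i) = (s, v)"
    "\<And>i. i < 4 \<Longrightarrow> coarse (g i) = (s, v')" "\<And>i. i < 4 \<Longrightarrow> slab_adj (f i) (g i)" "inj f" "inj g"
    using coarse_adjacent_links[OF adj, of s] by metis
  have vv': "v \<noteq> v'" using adj by auto
  have f: "i = j" if "i < 4" "j < 4" "bad {f i}" "bad {f j}" for i j
  proof -
    have "f i = f j" using one_defectD[OF v that(3,4)] fg that by simp
    then show ?thesis using fg(4) by (simp add: inj_eq)
  qed
  have g: "i = j" if "i < 4" "j < 4" "bad {g i}" "bad {g j}" for i j
  proof -
    have "g i = g j" using one_defectD[OF v' that(3,4)] fg that by simp
    then show ?thesis using fg(5) by (simp add: inj_eq)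
  qed
  have l: "i = j" if "i < 4" "j < 4" "bad {f i, g i}" "bad {f j, g j}" for i j
  proof -
    have "{f i, g i} = {f j, g j}" using links fg that by (simp add: slab_edge_iff)
    moreover have "f i \<noteq> g j" using fg(1)[OF that(1)] fg(2)[OF that(2)] vv' by auto
    ultimately show ?thesis using fg(4) by (auto simp: doubleton_eq_iff inj_eq)
  qed
  have "\<exists>i<4. \<not> bad {f i} \<and> \<not> bad {g i} \<and> \<not> bad {f i, g i}"
  proof (rule ccontr)
    assume "\<not> ?thesis"
    then have *: "bad {f i} \<or> bad {g i} \<or> bad {f i, g i}" if "i < 4" for i using that by blast
    show False
      using *[of 0] *[of 1] *[of 2] *[of 3]
        f[of 0 1] f[of 0 2] f[of 0 3] f[of 1 2] f[of 1 3] f[of 2 3]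
        g[of 0 1] g[of 0 2] g[of 0 3] g[of 1 2] g[of 1 3] g[of 2 3]
        l[of 0 1] l[of 0 2] l[of 0 3] l[of 1 2] l[of 1 3] l[of 2 3] by simp argo
  qed
  then show ?thesis using that fg by metis
qed

section \<open>The hierarchy of coarse slabs\<close>

text \<open>Each coarsening step moves the slab by an automorphism \<open>\<alpha> n\<close> first. After \<open>n\<close> steps a vertex lies
  in the vertex \<open>v\<close> of the coarse slab \<open>w\<close> (most recent choice first), where \<open>label \<alpha> n u = (w, v)\<close>.\<close>

primrec label :: "(nat \<Rightarrow> vtx \<Rightarrow> vtx) \<Rightarrow> nat \<Rightarrow> vtx \<Rightarrow> bool list \<times> vtx" where
  "label \<alpha> 0 u = ([], u)"
| "label \<alpha> (Suc n) u = (case label \<alpha> n u of (w, v) \<Rightarrow> case coarse (\<alpha> n v) of (s, v') \<Rightarrow> (s # w, v'))"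

definition hierarchy :: "(nat \<Rightarrow> vtx \<Rightarrow> vtx) \<Rightarrow> edge set" where
  "hierarchy \<alpha> = {{u, v} | u v. slab_adj u v \<and> (\<exists>n. label \<alpha> n u = label \<alpha> n v)}"

lemma hierarchy_subset: "hierarchy \<alpha> \<subseteq> slab_edges"
  by (auto simp: hierarchy_def slab_edge_iff)

lemma hierarchy_iff: "{u, v} \<in> hierarchy \<alpha> \<longleftrightarrow> slab_adj u v \<and> (\<exists>n. label \<alpha> n u = label \<alpha> n v)"
proof
  assume "{u, v} \<in> hierarchy \<alpha>"
  then obtain a b n where "{u, v} = {a, b}" "slab_adj a b" "label \<alpha> n a = label \<alpha> n b"
    unfolding hierarchy_def by blast
  then show "slab_adj u v \<and> (\<exists>n. label \<alpha> n u = label \<alpha> n v)"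
    unfolding doubleton_eq_iff using slab_adj_sym by metis
qed (auto simp: hierarchy_def)

lemma length_label: "length (fst (label \<alpha> n u)) = n"
  by (induction n) (auto split: prod.splits)

lemma label_mono: "label \<alpha> n u = label \<alpha> n v \<Longrightarrow> n \<le> m \<Longrightarrow> label \<alpha> m u = label \<alpha> m v"
  by (induction m) (auto simp: le_Suc_eq)

text \<open>Words grow at the head, and the earlier word remains as a tail. Hence vertices in
  different coarse slabs of one scale never receive equal labels later.\<close>

lemma label_word_mono:
  "fst (label \<alpha> m u) = fst (label \<alpha> m v) \<Longrightarrow> n \<le> m \<Longrightarrow> fst (label \<alpha> n u) = fst (label \<alpha> n v)"
  by (induction m) (auto simp: le_Suc_eq split: prod.splits)

lemma label_surj:
  assumes "\<And>n. slab_aut (\<alpha> n)"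
  shows "length w = n \<Longrightarrow> \<exists>u. label \<alpha> n u = (w, v)"
proof (induction n arbitrary: w v)
  case (Suc n)
  then obtain s w' where w: "w = s # w'" "length w' = n" by (cases w) auto
  obtain z where "coarse z = (s, v)" using coarse_surj by blast
  moreover obtain v' where "\<alpha> n v' = z" using slab_aut_bij[OF assms] by (metis bij_pointE)
  moreover obtain u where "label \<alpha> n u = (w', v')" using Suc.IH w by blast
  ultimately show ?case using w by (intro exI[of _ u]) simp
qed simp

lemma hierarchy_connected_label:
  assumes "v \<in> cluster_of (hierarchy \<alpha>) u"
  shows "\<exists>n. label \<alpha> n u = label \<alpha> n v"
proof -
  have "(u, v) \<in> {(a, b). {a, b} \<in> hierarchy \<alpha>}\<^sup>*" using assms by (simp add: cluster_of_def)
  then show ?thesis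
  proof induction
    case (step y z)
    then obtain n m where "label \<alpha> n u = label \<alpha> n y" "label \<alpha> m y = label \<alpha> m z"
      by (auto simp: hierarchy_iff)
    then have "label \<alpha> (max n m) u = label \<alpha> (max n m) y" "label \<alpha> (max n m) y = label \<alpha> (max n m) z"
      by (auto elim: label_mono)
    then show ?case by metis
  qed simp
qed

lemma hierarchy_new_cluster:
  assumes "\<And>n. slab_aut (\<alpha> n)"
  shows "\<exists>v. \<forall>x\<in>set xs. v \<notin> cluster_of (hierarchy \<alpha>) x"
proof -
  define n where "n = length xs"
  have "card (set (map (\<lambda>x. fst (label \<alpha> n x)) xs)) \<le> n"
    by (metis card_length length_map n_def)
  also have "n < 2 ^ n" by simp
  also have "2 ^ n = card {w :: bool list. set w \<subseteq> UNIV \<and> length w = n}"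
    by (subst card_lists_length_eq) simp_all
  finally have "\<not> {w :: bool list. set w \<subseteq> UNIV \<and> length w = n} \<subseteq> set (map (\<lambda>x. fst (label \<alpha> n x)) xs)"
    by (meson List.finite_set card_mono not_le)
  then obtain w :: "bool list" where w: "length w = n" "w \<notin> set (map (\<lambda>x. fst (label \<alpha> n x)) xs)" by blast
  obtain v where v: "label \<alpha> n v = (w, (0, 0, False))" using label_surj[where \<alpha> = \<alpha>, OF assms w(1)] by blast
  have "v \<notin> cluster_of (hierarchy \<alpha>) x" if x: "x \<in> set xs" for x
  proof
    assume "v \<in> cluster_of (hierarchy \<alpha>) x"
    then obtain m where "label \<alpha> m x = label \<alpha> m v" using hierarchy_connected_label by blast
    then have "label \<alpha> (max m n) x = label \<alpha> (max m n) v" by (auto elim: label_mono)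
    then have "fst (label \<alpha> n x) = fst (label \<alpha> n v)" using label_word_mono[of \<alpha> "max m n" x v n] by simp
    then show False using w v x by auto
  qed
  then show ?thesis by blast
qed

section \<open>Bad atoms\<close>

text \<open>For a vertex these are the vertices and edges inside its cross; for an edge they are the
  edges joining the two crosses.\<close>

definition children :: "(vtx \<Rightarrow> vtx) \<Rightarrow> bool \<Rightarrow> vtx set \<Rightarrow> vtx set set" where
  "children f s a = {c \<in> atoms. (\<lambda>u. coarse (f u)) ` c = Pair s ` a}"

text \<open>An atom is bad if at least two of its children are; a base edge is bad if it is closed. The
  witnesses are the inclusion-minimal sets of closed edges which make an atom bad.\<close>

primrec witnesses :: "(nat \<Rightarrow> vtx \<Rightarrow> vtx) \<Rightarrow> bool list \<Rightarrow> vtx set \<Rightarrow> edge set set" where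
  "witnesses \<alpha> [] a = (if a \<in> slab_edges then {{a}} else {})"
| "witnesses \<alpha> (s # w) a = {S \<union> S' | S S'. \<exists>c c'. c \<in> children (\<alpha> (length w)) s a \<and>
     c' \<in> children (\<alpha> (length w)) s a \<and> c \<noteq> c' \<and> S \<in> witnesses \<alpha> w c \<and> S' \<in> witnesses \<alpha> w c'}"

definition bad :: "(nat \<Rightarrow> vtx \<Rightarrow> vtx) \<Rightarrow> (edge \<Rightarrow> bool) \<Rightarrow> bool list \<Rightarrow> vtx set \<Rightarrow> bool" where
  "bad \<alpha> \<eta> w a \<longleftrightarrow> (\<exists>S\<in>witnesses \<alpha> w a. \<forall>e\<in>S. \<not> \<eta> e)"

lemma bad_Nil: "bad \<alpha> \<eta> [] a \<longleftrightarrow> a \<in> slab_edges \<and> \<not> \<eta> a"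
  by (auto simp: bad_def)

lemma bad_ConsI:
  assumes "c \<in> children (\<alpha> (length w)) s a" "c' \<in> children (\<alpha> (length w)) s a" "c \<noteq> c'"
    "bad \<alpha> \<eta> w c" "bad \<alpha> \<eta> w c'"
  shows "bad \<alpha> \<eta> (s # w) a"
proof -
  obtain S S' where "S \<in> witnesses \<alpha> w c" "S' \<in> witnesses \<alpha> w c'" "\<forall>e\<in>S \<union> S'. \<not> \<eta> e"
    using assms(4,5) unfolding bad_def by blast
  moreover from this assms(1-3) have "S \<union> S' \<in> witnesses \<alpha> (s # w) a"
    unfolding witnesses.simps mem_Collect_eq by blast
  ultimately show ?thesis unfolding bad_def by blast
qed

text \<open>The labels of the ends of an edge in a witness recover the atom, so witnesses of
  distinct children are disjoint and the cardinality doubles at every level. This is why the claim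
  on labels is proved in the same induction.\<close>

lemma witness_properties:
  assumes "S \<in> witnesses \<alpha> w a"
  shows "S \<subseteq> slab_edges" "finite S" "card S = 2 ^ length w"
    "\<And>e. e \<in> S \<Longrightarrow> label \<alpha> (length w) ` e = Pair w ` a"
proof -
  have "S \<subseteq> slab_edges \<and> finite S \<and> card S = 2 ^ length w \<and>
      (\<forall>e\<in>S. label \<alpha> (length w) ` e = Pair w ` a)"
    using assms
  proof (induction w arbitrary: S a)
    case Nil
    then show ?case by (auto split: if_splits)
  next
    case (Cons s w)
    obtain S1 S2 c1 c2 where S: "S = S1 \<union> S2"
      and c: "c1 \<in> children (\<alpha> (length w)) s a" "c2 \<in> children (\<alpha> (length w)) s a" "c1 \<noteq> c2"
      and W: "S1 \<in> witnesses \<alpha> w c1" "S2 \<in> witnesses \<alpha> w c2"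
      using Cons.prems by auto
    note IH = Cons.IH[OF W(1)] Cons.IH[OF W(2)]
    have L: "\<forall>e\<in>S1. label \<alpha> (length w) ` e = Pair w ` c1" "\<forall>e\<in>S2. label \<alpha> (length w) ` e = Pair w ` c2"
      subgoal using IH(1) by (elim conjE)
      subgoal using IH(2) by (elim conjE)
      done
    have disj: "S1 \<inter> S2 = {}"
    proof (rule ccontr)
      assume "S1 \<inter> S2 \<noteq> {}"
      then obtain e where "e \<in> S1" "e \<in> S2" by blast
      then have "Pair w ` c1 = Pair w ` c2" using L by (metis (no_types))
      then show False using c by (metis Pair_inject inj_image_eq_iff injI)
    qed
    have lift: "label \<alpha> (Suc (length w)) ` e = Pair (s # w) ` a"
      if "label \<alpha> (length w) ` e = Pair w ` c" "c \<in> children (\<alpha> (length w)) s a" for e c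
    proof -
      have "label \<alpha> (Suc (length w)) ` e =
          (\<lambda>(w, v). case coarse (\<alpha> (length w) v) of (s, v') \<Rightarrow> (s # w, v')) ` label \<alpha> (length w) ` e"
        unfolding image_image by (rule image_cong) (auto simp: length_label split: prod.splits dest: arg_cong[of _ _ "\<lambda>p. length (fst p)"])
      also have "\<dots> = (\<lambda>(s, v'). (s # w, v')) ` (\<lambda>v. coarse (\<alpha> (length w) v)) ` c"
        unfolding that(1) image_image by (rule image_cong) auto
      also have "\<dots> = Pair (s # w) ` a"
        using that(2) by (auto simp: children_def image_image)
      finally show ?thesis .
    qed
    have "label \<alpha> (length (s # w)) ` e = Pair (s # w) ` a" if "e \<in> S1 \<union> S2" for e
      using that lift[OF bspec[OF L(1)] c(1)] lift[OF bspec[OF L(2)] c(2)]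
      unfolding length_Cons by (elim UnE)
    moreover have "card (S1 \<union> S2) = 2 ^ length (s # w)"
      using IH disj by (simp add: card_Un_disjoint)
    ultimately show ?case using IH unfolding S by (intro conjI ballI) (simp_all del: label.simps)
  qed
  then show "S \<subseteq> slab_edges" "finite S" "card S = 2 ^ length w"
    "\<And>e. e \<in> S \<Longrightarrow> label \<alpha> (length w) ` e = Pair w ` a" by auto
qed

text \<open>A child of an atom is a subset of at most two fibres with at most 512 vertices each.\<close>

definition children_bound :: nat where
  "children_bound = 2 ^ 1024"

lemma children_bound_pos: "children_bound > 0"
  by (simp add: children_bound_def)

lemma children_le:
  assumes "slab_aut f" "a \<in> atoms"
  shows "finite (children f s a)" "card (children f s a) \<le> children_bound"
proof -
  let ?F = "\<lambda>v. {u. coarse (f u) = (s, v)}"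
  let ?U = "\<Union>v\<in>a. ?F v"
  have F: "?F v = f -` {u. coarse u = (s, v)}" for v by auto
  have bij: "bij f" using assms(1) by (rule slab_aut_bij)
  have finF: "finite (?F v)" for v
    unfolding F using bij card_coarse_fibre(1) by (intro finite_vimageI) (auto simp: bij_is_inj)
  have cardF: "card (?F v) \<le> 512" for v
  proof -
    have "card (f -` {u. coarse u = (s, v)}) = card {u. coarse u = (s, v)}"
      using bij by (intro card_vimage_inj) (auto simp: bij_is_inj bij_is_surj)
    then show ?thesis unfolding F using card_coarse_fibre(2) by simp
  qed
  have a: "finite a" "card a \<le> 2" using assms(2) by (elim atomE; simp)+
  have finU: "finite ?U" using a finF by blast
  have "card ?U \<le> (\<Sum>v\<in>a. card (?F v))" using a(1) by (rule card_UN_le)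
  also have "\<dots> \<le> (\<Sum>v\<in>a. 512)" by (intro sum_mono cardF)
  also have "\<dots> \<le> 1024" using a(2) by simp
  finally have cardU: "card ?U \<le> 1024" .
  have sub: "children f s a \<subseteq> Pow ?U"
  proof
    fix c assume "c \<in> children f s a"
    then have "coarse (f u) \<in> Pair s ` a" if "u \<in> c" for u using that by (auto simp: children_def)
    then show "c \<in> Pow ?U" by blast
  qed
  then show "finite (children f s a)" using finU by (meson finite_Pow_iff finite_subset)
  have "card (children f s a) \<le> card (Pow ?U)" using sub finU by (intro card_mono) auto
  also have "\<dots> = 2 ^ card ?U" using finU by (rule card_Pow)
  also have "\<dots> \<le> 2 ^ 1024" using cardU by (intro power_increasing) auto
  finally show "card (children f s a) \<le> children_bound" by (simp only: children_bound_def)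
qed

text \<open>With \<open>M\<close> children at most, the largest number \<open>A n\<close> of
  witnesses at level \<open>n\<close> satisfies \<open>A (n + 1) \<le> (M * A n)^2\<close>. The
  factor \<open>M^2\<close> makes this a pure squaring:
  \<open>M^2 * A (n + 1) \<le> (M^2 * A n)^2\<close>, starting from
  \<open>A 0 \<le> 1\<close>.\<close>

lemma card_witnesses:
  assumes "\<And>n. slab_aut (\<alpha> n)" "a \<in> atoms"
  shows "finite (witnesses \<alpha> w a) \<and>
    card (witnesses \<alpha> w a) * children_bound ^ 2 \<le> (children_bound ^ 2) ^ (2 ^ length w)"
  using assms(2)
proof (induction w arbitrary: a)
  case (Cons s w)
  let ?C = "children (\<alpha> (length w)) s a"
  let ?W = "\<Union>c\<in>?C. witnesses \<alpha> w c"
  let ?M = children_bound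
  let ?K = "(?M ^ 2) ^ (2 ^ length w)"
  note C = children_le[OF assms(1) Cons.prems, of "length w" s]
  have IH: "finite (witnesses \<alpha> w c)" "card (witnesses \<alpha> w c) * ?M ^ 2 \<le> ?K" if "c \<in> ?C" for c
    using Cons.IH[of c] that by (auto simp: children_def)
  have finW: "finite ?W" using C(1) IH(1) by blast
  have "card ?W * ?M ^ 2 \<le> (\<Sum>c\<in>?C. card (witnesses \<alpha> w c)) * ?M ^ 2"
    using C(1) by (intro mult_right_mono card_UN_le) auto
  also have "\<dots> \<le> (\<Sum>c\<in>?C. ?K)" unfolding sum_distrib_right by (intro sum_mono IH(2))
  also have "\<dots> \<le> ?M * ?K" using C(2) by simp
  finally have "card ?W * ?M \<le> ?K" using children_bound_pos by (simp add: power2_eq_square)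
  then have W: "(card ?W * ?M) ^ 2 \<le> ?K ^ 2" by (intro power_mono) auto
  have sub: "witnesses \<alpha> (s # w) a \<subseteq> (\<lambda>(S, S'). S \<union> S') ` (?W \<times> ?W)" by auto
  have finWW: "finite (?W \<times> ?W)" using finW by simp
  have "card (witnesses \<alpha> (s # w) a) \<le> card ((\<lambda>(S, S'). S \<union> S') ` (?W \<times> ?W))"
    by (rule card_mono[OF finite_imageI[OF finWW] sub])
  also have "\<dots> \<le> card (?W \<times> ?W)" by (rule card_image_le[OF finWW])
  finally have card_le: "card (witnesses \<alpha> (s # w) a) \<le> card (?W \<times> ?W)" .
  have "card (witnesses \<alpha> (s # w) a) * ?M ^ 2 \<le> card (?W \<times> ?W) * ?M ^ 2"
    by (rule mult_right_mono[OF card_le]) simp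
  also have "\<dots> = (card ?W * ?M) ^ 2"
    by (simp add: card_cartesian_product power2_eq_square)
  also note W
  also have "?K ^ 2 = (?M ^ 2) ^ (2 ^ length (s # w))" by (simp add: power_mult[symmetric] mult.commute)
  finally show ?case using finite_subset[OF sub finite_imageI[OF finWW]] by blast
qed auto

section \<open>Good vertices have connected cores\<close>

text \<open>The base vertices reached from \<open>v\<close> by descending through constituents that
  are not bad at any level. The vertex \<open>v\<close> itself is not tested.\<close>

primrec core :: "(nat \<Rightarrow> vtx \<Rightarrow> vtx) \<Rightarrow> (edge \<Rightarrow> bool) \<Rightarrow> bool list \<Rightarrow> vtx \<Rightarrow> vtx set" where
  "core \<alpha> \<eta> [] v = {v}"
| "core \<alpha> \<eta> (s # w) v =
     (\<Union>u\<in>{u. coarse (\<alpha> (length w) u) = (s, v) \<and> \<not> bad \<alpha> \<eta> w {u}}. core \<alpha> \<eta> w u)"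

lemma core_label: "x \<in> core \<alpha> \<eta> w v \<Longrightarrow> label \<alpha> (length w) x = (w, v)"
  by (induction w arbitrary: v) auto

lemma core_Cons_superset:
  "coarse (\<alpha> (length w) u) = (s, v) \<Longrightarrow> \<not> bad \<alpha> \<eta> w {u} \<Longrightarrow> core \<alpha> \<eta> w u \<subseteq> core \<alpha> \<eta> (s # w) v"
  by auto

definition open_steps :: "(edge \<Rightarrow> bool) \<Rightarrow> vtx set \<Rightarrow> (vtx \<times> vtx) set" where
  "open_steps \<eta> X = {(x, y). x \<in> X \<and> y \<in> X \<and> slab_adj x y \<and> \<eta> {x, y}}"

lemma open_steps_mono: "X \<subseteq> Y \<Longrightarrow> (open_steps \<eta> X)\<^sup>* \<subseteq> (open_steps \<eta> Y)\<^sup>*"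
  by (rule rtrancl_mono) (auto simp: open_steps_def)

lemma atom_image: "slab_aut f \<Longrightarrow> c \<in> atoms \<Longrightarrow> f ` c \<in> atoms"
  by (auto simp: atoms_def slab_aut_edge)

lemma inv_image_children:
  assumes f: "slab_aut f" and "c \<in> atoms" "coarse ` c = Pair s ` a"
  shows "inv f ` c \<in> children f s a"
proof -
  have "(\<lambda>u. coarse (f u)) ` inv f ` c = coarse ` c"
    using slab_aut_bij[OF f] by (simp add: image_image bij_is_surj surj_f_inv_f)
  then show ?thesis using assms atom_image[OF slab_aut_inv[OF f]] by (simp add: children_def)
qed

lemma inv_image_eq_iff: "slab_aut f \<Longrightarrow> inv f ` c = inv f ` c' \<longleftrightarrow> c = c'"
  using slab_aut_bij[OF slab_aut_inv, of f] by (simp add: bij_is_inj inj_image_eq_iff)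

text \<open>Two failed atoms in the cross would pull back to two bad children and make
  \<open>v\<close> bad. This connects badness with the geometry of a cross with one defect.\<close>

lemma good_vertex_one_defect:
  assumes f: "slab_aut (\<alpha> (length w))" and "\<not> bad \<alpha> \<eta> (s # w) {v}"
  shows "one_defect (\<lambda>c. bad \<alpha> \<eta> w (inv (\<alpha> (length w)) ` c)) {u. coarse u = (s, v)}"
  unfolding one_defect_def
proof (intro ballI impI, rule ccontr)
  fix c c' assume *: "c \<in> atoms" "c' \<in> atoms" "c \<subseteq> {u. coarse u = (s, v)}" "c' \<subseteq> {u. coarse u = (s, v)}"
    "bad \<alpha> \<eta> w (inv (\<alpha> (length w)) ` c)" "bad \<alpha> \<eta> w (inv (\<alpha> (length w)) ` c')" "c \<noteq> c'"
  let ?g = "inv (\<alpha> (length w))"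
  have "?g ` c \<in> children (\<alpha> (length w)) s {v}" if c: "c \<in> atoms" "c \<subseteq> {u. coarse u = (s, v)}" for c
  proof (rule inv_image_children[OF f c(1)])
    have "c \<noteq> {}" using c(1) by (auto elim: atomE)
    have "coarse ` c = (\<lambda>_. (s, v)) ` c" using c(2) by (intro image_cong) auto
    then show "coarse ` c = Pair s ` {v}" using \<open>c \<noteq> {}\<close> by (simp add: image_constant_conv)
  qed
  then have "?g ` c \<in> children (\<alpha> (length w)) s {v}" "?g ` c' \<in> children (\<alpha> (length w)) s {v}"
    using * by blast+
  moreover have "?g ` c \<noteq> ?g ` c'"
    using \<open>c \<noteq> c'\<close> inv_image_eq_iff[OF f] by simp
  ultimately show False using *(5,6) assms(2) bad_ConsI by blast
qed

text \<open>A good edge has at most one bad child, and each of its good ends has a cross with at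
  most one defect, so some link between the crosses is intact. This link is a good edge with good
  ends one level below; at level 0 it is an open edge.\<close>

lemma good_link_core:
  assumes aut: "\<And>n. slab_aut (\<alpha> n)"
  shows "slab_adj v v' \<Longrightarrow> \<not> bad \<alpha> \<eta> w {v} \<Longrightarrow> \<not> bad \<alpha> \<eta> w {v'} \<Longrightarrow> \<not> bad \<alpha> \<eta> w {v, v'} \<Longrightarrow>
    \<exists>x\<in>core \<alpha> \<eta> w v. \<exists>y\<in>core \<alpha> \<eta> w v'. slab_adj x y \<and> \<eta> {x, y}"
proof (induction w arbitrary: v v')
  case Nil
  then show ?case by (auto simp: bad_Nil slab_edge_iff)
next
  case (Cons s w)
  let ?f = "\<alpha> (length w)" let ?g = "inv ?f"
  let ?bad = "\<lambda>c. bad \<alpha> \<eta> w (?g ` c)"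
  have fg: "?f (?g u) = u" for u using slab_aut_bij[OF aut] by (simp add: bij_is_surj surj_f_inv_f)
  have links: "c = c'"
    if c: "c \<in> slab_edges" "c' \<in> slab_edges" "coarse ` c = {(s, v), (s, v')}" "coarse ` c' = {(s, v), (s, v')}"
      "?bad c" "?bad c'" for c c'
  proof (rule ccontr)
    assume "c \<noteq> c'"
    then have "?g ` c \<noteq> ?g ` c'" using inv_image_eq_iff[OF aut] by simp
    moreover have "?g ` c \<in> children ?f s {v, v'}" "?g ` c' \<in> children ?f s {v, v'}"
      using c by (auto intro!: inv_image_children[OF aut] simp: atoms_def)
    ultimately show False using c(5,6) Cons.prems(4) bad_ConsI by blast
  qed
  obtain u u' where u: "coarse u = (s, v)" "coarse u' = (s, v')" "slab_adj u u'"
    "\<not> ?bad {u}" "\<not> ?bad {u'}" "\<not> ?bad {u, u'}"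
    using good_link[OF Cons.prems(1) good_vertex_one_defect[OF aut Cons.prems(2)]
        good_vertex_one_defect[OF aut Cons.prems(3)] links] by blast
  have "slab_adj (?g u) (?g u')" using u(3) slab_aut_adj[OF slab_aut_inv[OF aut]] by simp
  then obtain x y where "x \<in> core \<alpha> \<eta> w (?g u)" "y \<in> core \<alpha> \<eta> w (?g u')" "slab_adj x y \<and> \<eta> {x, y}"
    using Cons.IH[of "?g u" "?g u'"] u by auto
  moreover have "core \<alpha> \<eta> w (?g u) \<subseteq> core \<alpha> \<eta> (s # w) v" "core \<alpha> \<eta> w (?g u') \<subseteq> core \<alpha> \<eta> (s # w) v'"
    using core_Cons_superset[of \<alpha> w "?g u" s v \<eta>] core_Cons_superset[of \<alpha> w "?g u'" s v' \<eta>]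
      u fg[of u] fg[of u'] by simp_all
  ultimately show ?case by blast
qed

text \<open>At most one vertex of the cross is bad, so three distinct ones contain two good ones.
  Two are wanted so that cores grow strictly from level to level.\<close>

lemma two_good_children:
  assumes aut: "\<And>n. slab_aut (\<alpha> n)" and "\<not> bad \<alpha> \<eta> (s # w) {v}"
  shows "\<exists>u u'. u \<noteq> u' \<and> coarse (\<alpha> (length w) u) = (s, v) \<and> coarse (\<alpha> (length w) u') = (s, v) \<and>
    \<not> bad \<alpha> \<eta> w {u} \<and> \<not> bad \<alpha> \<eta> w {u'}"
proof -
  let ?f = "\<alpha> (length w)" let ?g = "inv ?f"
  have fg: "?f (?g u) = u" for u using slab_aut_bij[OF aut] by (simp add: bij_is_surj surj_f_inv_f)
  \<comment> \<open>Any neighbour serves: the links towards it only supply distinct vertices in the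
    cross of \<open>v\<close>.\<close>
  obtain v' where "slab_adj v v'" by (cases v) (auto simp: slab_adj_iff)
  then obtain h h' :: "nat \<Rightarrow> vtx" where h: "\<And>i. i < 4 \<Longrightarrow> coarse (h i) = (s, v)" "inj h"
    using coarse_adjacent_links[of v v' s] by metis
  have D: "p = q" if "coarse p = (s, v)" "coarse q = (s, v)" "bad \<alpha> \<eta> w {?g p}" "bad \<alpha> \<eta> w {?g q}" for p q
    using one_defectD[OF good_vertex_one_defect[OF aut assms(2)], of p q] that by simp
  have ne: "h i \<noteq> h j" "?g (h i) \<noteq> ?g (h j)" if "i \<noteq> j" for i j
    using that h(2) fg by (metis injD)+
  show ?thesis
  proof (cases "bad \<alpha> \<eta> w {?g (h 0)}")
    case True
    then have "\<not> bad \<alpha> \<eta> w {?g (h 1)}" "\<not> bad \<alpha> \<eta> w {?g (h 2)}"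
      using D[of "h 0" "h 1"] D[of "h 0" "h 2"] h(1) ne by auto
    then show ?thesis using ne[of 1 2] h(1) fg by (intro exI[of _ "?g (h 1)"] exI[of _ "?g (h 2)"]) simp
  next
    case 0: False
    show ?thesis
    proof (cases "bad \<alpha> \<eta> w {?g (h 1)}")
      case True
      then have "\<not> bad \<alpha> \<eta> w {?g (h 2)}" using D[of "h 1" "h 2"] h(1) ne by auto
      then show ?thesis using 0 ne[of 0 2] h(1) fg by (intro exI[of _ "?g (h 0)"] exI[of _ "?g (h 2)"]) simp
    next
      case False
      then show ?thesis using 0 ne[of 0 1] h(1) fg by (intro exI[of _ "?g (h 0)"] exI[of _ "?g (h 1)"]) simp
    qed
  qed
qed

text \<open>The good constituents of a good vertex are joined by paths inside its cross. By
  induction each has a connected core, and every step of such a path is realised by an open edge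
  between consecutive cores.\<close>

lemma good_core:
  assumes aut: "\<And>n. slab_aut (\<alpha> n)"
  shows "\<not> bad \<alpha> \<eta> w {v} \<Longrightarrow> core \<alpha> \<eta> w v \<noteq> {} \<and>
    (\<forall>x\<in>core \<alpha> \<eta> w v. \<forall>y\<in>core \<alpha> \<eta> w v. (x, y) \<in> (open_steps \<eta> (core \<alpha> \<eta> w v))\<^sup>*)"
proof (induction w arbitrary: v)
  case (Cons s w)
  let ?f = "\<alpha> (length w)" let ?g = "inv ?f"
  let ?bad = "\<lambda>c. bad \<alpha> \<eta> w (?g ` c)"
  let ?X = "core \<alpha> \<eta> (s # w) v"
  let ?S = "(open_steps \<eta> ?X)\<^sup>*"
  let ?R = "{u. coarse u = (s, v)}"
  have fg: "?f (?g u) = u" "?g (?f u) = u" for u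
    using slab_aut_bij[OF aut] by (simp_all add: bij_is_surj surj_f_inv_f bij_is_inj)
  have sub: "core \<alpha> \<eta> w u \<subseteq> ?X" if "coarse (?f u) = (s, v)" "\<not> bad \<alpha> \<eta> w {u}" for u
    using that by auto
  have inner: "(x, y) \<in> ?S" if u: "coarse (?f u) = (s, v)" "\<not> bad \<alpha> \<eta> w {u}"
    and xy: "x \<in> core \<alpha> \<eta> w u" "y \<in> core \<alpha> \<eta> w u" for u x y
    using Cons.IH[OF u(2)] xy open_steps_mono[OF sub[OF u]] by blast
  have path: "\<forall>x\<in>core \<alpha> \<eta> w (?g p). \<forall>y\<in>core \<alpha> \<eta> w (?g q). (x, y) \<in> ?S"
    if "(p, q) \<in> (good_steps ?bad ?R)\<^sup>*" "coarse p = (s, v)" "\<not> ?bad {p}" for p q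
    using that(1)
  proof induction
    case base
    then show ?case using inner[of "?g p"] that fg by auto
  next
    case (step q r)
    then have qr: "coarse q = (s, v)" "coarse r = (s, v)" "slab_adj q r"
      "\<not> ?bad {q}" "\<not> ?bad {r}" "\<not> ?bad {q, r}" by (auto simp: good_steps_def)
    have "slab_adj (?g q) (?g r)" using qr(3) slab_aut_adj[OF slab_aut_inv[OF aut]] by simp
    then obtain x' y' where xy: "x' \<in> core \<alpha> \<eta> w (?g q)" "y' \<in> core \<alpha> \<eta> w (?g r)"
      "slab_adj x' y'" "\<eta> {x', y'}"
      using good_link_core[where \<alpha> = \<alpha> and v = "?g q" and v' = "?g r" and \<eta> = \<eta> and w = w, OF aut] qr
      by auto
    have "(x', y') \<in> open_steps \<eta> ?X"
      using xy sub[of "?g q"] sub[of "?g r"] qr fg by (auto simp: open_steps_def)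
    moreover have "(y', y) \<in> ?S" if "y \<in> core \<alpha> \<eta> w (?g r)" for y
      using inner[of "?g r" y' y] that xy qr fg by auto
    ultimately show ?case using step.IH xy(1) by (meson converse_rtrancl_into_rtrancl rtrancl_trans)
  qed
  have "(x, y) \<in> ?S" if "x \<in> ?X" "y \<in> ?X" for x y
  proof -
    obtain p q where p: "coarse (?f p) = (s, v)" "\<not> bad \<alpha> \<eta> w {p}" "x \<in> core \<alpha> \<eta> w p"
      and q: "coarse (?f q) = (s, v)" "\<not> bad \<alpha> \<eta> w {q}" "y \<in> core \<alpha> \<eta> w q"
      using \<open>x \<in> ?X\<close> \<open>y \<in> ?X\<close> by auto
    have "(?f p, ?f q) \<in> (good_steps ?bad ?R)\<^sup>*"
      using coarse_fibre_connected[OF good_vertex_one_defect[OF aut Cons.prems], of "?f p" "?f q"] p q fg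
      by simp
    from path[OF this] show ?thesis using p q fg by simp
  qed
  moreover obtain u where "coarse (?f u) = (s, v)" "\<not> bad \<alpha> \<eta> w {u}"
    using two_good_children[where \<alpha> = \<alpha>, OF aut Cons.prems] by blast
  then have "?X \<noteq> {}" using sub Cons.IH by blast
  ultimately show ?case by blast
qed simp

text \<open>If no ancestor of \<open>z\<close> is bad, the cores of its ancestors form a strictly
  increasing chain of connected sets containing \<open>z\<close>, so the open cluster of
  \<open>z\<close> is infinite.\<close>

lemma infinite_open_cluster:
  assumes aut: "\<And>n. slab_aut (\<alpha> n)"
    and good: "\<And>n. \<not> bad \<alpha> \<eta> (fst (label \<alpha> n z)) {snd (label \<alpha> n z)}"
  shows "infinite (cluster_of {e \<in> hierarchy \<alpha>. \<eta> e} z)" (is "infinite ?C")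
proof
  assume fin: "finite ?C"
  define K where "K n = core \<alpha> \<eta> (fst (label \<alpha> n z)) (snd (label \<alpha> n z))" for n
  have K_label: "label \<alpha> n x = label \<alpha> n z" if "x \<in> K n" for x n
    using core_label[of x \<alpha> \<eta>] that by (metis K_def length_label prod.collapse)
  have step: "K n \<subset> K (Suc n)" for n
  proof -
    obtain w v where wv: "label \<alpha> n z = (w, v)" by (cases "label \<alpha> n z")
    obtain s v' where sv: "coarse (\<alpha> n v) = (s, v')" by (cases "coarse (\<alpha> n v)")
    have n: "length w = n" using length_label[of \<alpha> n z] wv by simp
    have K: "K n = core \<alpha> \<eta> w v" "K (Suc n) = core \<alpha> \<eta> (s # w) v'" by (simp_all add: K_def wv sv)
    have g: "\<not> bad \<alpha> \<eta> w {v}" "\<not> bad \<alpha> \<eta> (s # w) {v'}"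
      using good[of n] good[of "Suc n"] by (simp_all add: wv sv)
    \<comment> \<open>A good constituent other than the one containing \<open>z\<close>: its core
      has a different label at level \<open>n\<close>, so it is disjoint from \<open>K n\<close> and
      enlarges the next core.\<close>
    obtain u where u: "u \<noteq> v" "coarse (\<alpha> n u) = (s, v')" "\<not> bad \<alpha> \<eta> w {u}"
      using two_good_children[where \<alpha> = \<alpha>, OF aut g(2)] n by metis
    obtain x where x: "x \<in> core \<alpha> \<eta> w u" using good_core[where \<alpha> = \<alpha>, OF aut u(3)] by blast
    have "x \<in> K (Suc n)" using x u n by (auto simp: K)
    moreover have "x \<notin> K n"
      using core_label[OF x] K_label[of x n] u wv n by auto
    moreover have "K n \<subseteq> K (Suc n)" using g sv n by (auto simp: K)
    ultimately show ?thesis by blast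
  qed
  have z: "z \<in> K n" for n
  proof (induction n)
    case (Suc n)
    then show ?case using step by blast
  qed (simp add: K_def)
  have sub: "K n \<subseteq> ?C" for n
  proof
    fix x assume "x \<in> K n"
    then have "(z, x) \<in> (open_steps \<eta> (K n))\<^sup>*"
      using good_core[where \<alpha> = \<alpha>, OF aut good[of n]] z[of n] by (simp add: K_def)
    \<comment> \<open>All vertices of \<open>K n\<close> share the label of \<open>z\<close> at
      level \<open>n\<close>, so the hierarchy retains the edges between them.\<close>
    moreover have "open_steps \<eta> (K n) \<subseteq> {(a, b). {a, b} \<in> {e \<in> hierarchy \<alpha>. \<eta> e}}"
    proof clarify
      fix a b assume "(a, b) \<in> open_steps \<eta> (K n)"
      then have "slab_adj a b" "\<eta> {a, b}" "label \<alpha> n a = label \<alpha> n b"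
        using K_label[of _ n] by (auto simp: open_steps_def)
      then show "{a, b} \<in> hierarchy \<alpha> \<and> \<eta> {a, b}" by (auto simp: hierarchy_iff)
    qed
    ultimately show "x \<in> ?C" unfolding cluster_of_def using rtrancl_mono by blast
  qed
  have "n \<le> card (K n)" for n
  proof (induction n)
    case (Suc n)
    have "card (K n) < card (K (Suc n))"
      using step sub fin by (meson finite_subset psubset_card_mono)
    then show ?case using Suc by simp
  qed simp
  from this[of "Suc (card ?C)"] show False
    using card_mono[OF fin sub] by (meson Suc_n_not_le_n order_trans)
qed

section \<open>Percolation on the hierarchy\<close>

text \<open>Chosen so that \<open>children_bound ^ 2 * closed_prob\<close> is \<open>1/4\<close>,
  the base of the decay in the union bound over witnesses.\<close>

definition closed_prob :: real where
  "closed_prob = 1 / (4 * real children_bound ^ 2)"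

lemma closed_prob_bounds: "0 < closed_prob" "closed_prob \<le> 1"
proof -
  have "1 \<le> real children_bound" using children_bound_pos by linarith
  then have "1 \<le> real children_bound ^ 2" by (rule one_le_power)
  then have "1 \<le> 4 * real children_bound ^ 2" by linarith
  then show "0 < closed_prob" "closed_prob \<le> 1"
    unfolding closed_prob_def using children_bound_pos by (simp_all add: divide_le_eq)
qed

definition perc :: "edge set \<Rightarrow> (edge \<Rightarrow> bool) measure" where
  "perc F = PiM F (\<lambda>_. measure_pmf (bernoulli_pmf (1 - closed_prob)))"

lemma prob_space_perc: "prob_space (perc F)"
  unfolding perc_def by (intro prob_space_PiM prob_space_measure_pmf)

lemma measurable_perc [measurable]: "e \<in> F \<Longrightarrow> (\<lambda>\<eta>. \<eta> e) \<in> measurable (perc F) (count_space UNIV)"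
  unfolding perc_def by (rule measurable_compose[OF measurable_component_singleton]) auto

lemma measure_perc_closed:
  assumes "finite S" "S \<subseteq> F"
  shows "measure (perc F) {\<eta> \<in> space (perc F). \<forall>e\<in>S. \<not> \<eta> e} = closed_prob ^ card S"
proof -
  let ?M = "measure_pmf (bernoulli_pmf (1 - closed_prob))"
  interpret product_prob_space "\<lambda>_. ?M" F
    by (simp add: product_prob_spaceI prob_space_measure_pmf)
  have F: "emeasure ?M {False} = ennreal closed_prob"
    using closed_prob_bounds by (simp add: emeasure_pmf_single)
  have "emeasure (perc F) {\<eta> \<in> space (perc F). \<forall>e\<in>S. \<eta> e \<in> {False}} = (\<Prod>e\<in>S. emeasure ?M {False})"
    unfolding perc_def using assms by (intro emeasure_PiM_Collect) auto
  also have "\<dots> = ennreal (closed_prob ^ card S)"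
    unfolding F using closed_prob_bounds by (simp add: ennreal_power)
  finally show ?thesis using closed_prob_bounds by (simp add: measure_def)
qed

lemma sets_perc_closed:
  assumes "finite S" "S \<subseteq> F"
  shows "{\<eta> \<in> space (perc F). \<forall>e\<in>S. \<not> \<eta> e} \<in> sets (perc F)"
proof -
  have [measurable]: "(\<lambda>\<eta>. \<eta> e) \<in> measurable (perc F) (count_space UNIV)" if "e \<in> S" for e
    using that assms(2) measurable_perc by blast
  show ?thesis using assms(1) by measurable
qed

text \<open>A union bound: there are at most \<open>(M^2)^(2^n)\<close> witnesses, where
  \<open>M\<close> is \<open>children_bound\<close> and \<open>n\<close> the level, and each
  consists of \<open>2^n\<close> distinct edges, all closed with probability
  \<open>closed_prob^(2^n)\<close>.\<close>

lemma prob_bad: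
  assumes aut: "\<And>n. slab_aut (\<alpha> n)" and a: "a \<in> atoms"
  shows "{\<eta> \<in> space (perc slab_edges). bad \<alpha> \<eta> w a} \<in> sets (perc slab_edges)" (is "?B \<in> _")
    and "measure (perc slab_edges) {\<eta> \<in> space (perc slab_edges). bad \<alpha> \<eta> w a} \<le> (1/4) ^ Suc (length w)"
proof -
  interpret prob_space "perc slab_edges" by (rule prob_space_perc)
  let ?W = "witnesses \<alpha> w a"
  let ?E = "\<lambda>S. {\<eta> \<in> space (perc slab_edges). \<forall>e\<in>S. \<not> \<eta> e}"
  let ?M = "real children_bound"
  have W: "finite ?W" "card ?W * children_bound ^ 2 \<le> (children_bound ^ 2) ^ (2 ^ length w)"
    using card_witnesses[where \<alpha> = \<alpha>, OF aut a, of w] by blast+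
  have B: "?B = (\<Union>S\<in>?W. ?E S)" by (auto simp: bad_def)
  have E: "?E ` ?W \<subseteq> sets (perc slab_edges)"
    by (intro image_subsetI sets_perc_closed) (erule witness_properties)+
  then show "?B \<in> sets (perc slab_edges)" unfolding B using W(1) by (intro sets.finite_UN) auto
  have "measure (perc slab_edges) ?B \<le> (\<Sum>S\<in>?W. measure (perc slab_edges) (?E S))"
    unfolding B by (rule finite_measure_subadditive_finite[OF W(1) E])
  also have "\<dots> = (\<Sum>S\<in>?W. closed_prob ^ (2 ^ length w))"
  proof (rule sum.cong[OF refl])
    fix S assume S: "S \<in> ?W"
    show "measure (perc slab_edges) (?E S) = closed_prob ^ (2 ^ length w)"
      using measure_perc_closed[of S slab_edges] witness_properties(1-3)[OF S] by metis
  qed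
  also have "\<dots> = real (card ?W) * closed_prob ^ (2 ^ length w)" by simp
  also have "\<dots> \<le> (?M ^ 2) ^ (2 ^ length w) * closed_prob ^ (2 ^ length w)"
  proof (rule mult_right_mono)
    have "card ?W * 1 \<le> card ?W * children_bound ^ 2"
      using children_bound_pos by (intro mult_left_mono) auto
    then have "card ?W \<le> (children_bound ^ 2) ^ (2 ^ length w)" using W(2) by linarith
    then have "real (card ?W) \<le> real ((children_bound ^ 2) ^ (2 ^ length w))" by (rule of_nat_mono)
    then show "real (card ?W) \<le> (?M ^ 2) ^ (2 ^ length w)" by (simp only: of_nat_power)
  qed (use closed_prob_bounds in simp)
  also have "\<dots> = (?M ^ 2 * closed_prob) ^ (2 ^ length w)" by (rule power_mult_distrib[symmetric])
  also have "?M ^ 2 * closed_prob = 1 / 4"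
    unfolding closed_prob_def using children_bound_pos by (simp add: field_simps)
  \<comment> \<open>The doubly exponential decay is weakened by \<open>n + 1 \<le> 2^n\<close> to a
    geometric series, whose sum is explicit.\<close>
  also have "(1/4 :: real) ^ (2 ^ length w) \<le> (1/4) ^ Suc (length w)"
    by (rule power_decreasing) (auto simp: Suc_le_eq)
  finally show "measure (perc slab_edges) ?B \<le> (1/4) ^ Suc (length w)" .
qed

text \<open>Reduces both events to countable operations: connection by a path of some length, and
  infinity as not being contained in any finite list.\<close>

lemma measurable_cluster:
  assumes G: "\<And>e. Measurable.pred M (\<lambda>x. e \<in> G x)"
  shows "Measurable.pred M (\<lambda>x. w \<in> cluster_of (G x) v)"
    and "Measurable.pred M (\<lambda>x. infinite (cluster_of (G x) v))"
proof -
  have step: "Measurable.pred M (\<lambda>x. (v, w) \<in> {(a, b). {a, b} \<in> G x} ^^ n)" for n w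
  proof (induction n arbitrary: w)
    case (Suc n)
    have eq: "(v, w) \<in> {(a, b). {a, b} \<in> G x} ^^ Suc n \<longleftrightarrow>
        (\<exists>z. (v, z) \<in> {(a, b). {a, b} \<in> G x} ^^ n \<and> {z, w} \<in> G x)" for x
      by (auto simp: relcomp_unfold)
    show ?case unfolding eq by (intro pred_intros_countable(2) pred_intros_logic(3) Suc.IH G)
  qed simp
  have *: "Measurable.pred M (\<lambda>x. w \<in> cluster_of (G x) v)" for w
    unfolding cluster_of_def mem_Collect_eq rtrancl_power
    by (intro pred_intros_countable(2) step)
  then show "Measurable.pred M (\<lambda>x. w \<in> cluster_of (G x) v)" .
  have "infinite C \<longleftrightarrow> (\<forall>xs. \<exists>w. w \<in> C \<and> w \<notin> set xs)" for C :: "vtx set"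
    by (metis List.finite_set finite_list finite_subset subsetI)
  then have inf: "infinite (cluster_of (G x) v) \<longleftrightarrow>
      (\<forall>xs. \<exists>w. w \<in> cluster_of (G x) v \<and> w \<notin> set xs)" for x by simp
  show "Measurable.pred M (\<lambda>x. infinite (cluster_of (G x) v))"
    unfolding inf by (intro pred_intros_countable pred_intros_logic(3) *) simp
qed

lemma pred_perc_edge:
  "F \<subseteq> E \<Longrightarrow> Measurable.pred (perc E) (\<lambda>\<eta>. e \<in> {e \<in> F. \<eta> e})"
  using measurable_perc[of e E] by (cases "e \<in> F") auto

definition perc_infinite :: "edge set \<Rightarrow> vtx \<Rightarrow> (edge \<Rightarrow> bool) set" where
  "perc_infinite F v = {\<eta> \<in> space (perc slab_edges). infinite (cluster_of {e \<in> F. \<eta> e} v)}"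

lemma sets_perc_infinite: "F \<subseteq> slab_edges \<Longrightarrow> perc_infinite F v \<in> sets (perc slab_edges)"
  unfolding perc_infinite_def
  by (rule predE[OF measurable_cluster(2)[OF pred_perc_edge]])

text \<open>The probabilities that the ancestors of \<open>z\<close> are bad sum to at most
  \<open>1/3\<close>, so with positive probability no ancestor is bad.\<close>

lemma hierarchy_percolates:
  assumes aut: "\<And>n. slab_aut (\<alpha> n)"
  shows "measure (perc slab_edges) (perc_infinite (hierarchy \<alpha>) z) > 0"
proof -
  let ?P = "perc slab_edges"
  interpret prob_space ?P by (rule prob_space_perc)
  let ?B = "\<lambda>n. {\<eta> \<in> space ?P. bad \<alpha> \<eta> (fst (label \<alpha> n z)) {snd (label \<alpha> n z)}}"
  have B: "?B n \<in> sets ?P" "measure ?P (?B n) \<le> (1/4) ^ Suc n" for n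
    using prob_bad[where \<alpha> = \<alpha> and w = "fst (label \<alpha> n z)" and a = "{snd (label \<alpha> n z)}",
        OF aut singleton_atom] unfolding length_label .
  have geo: "summable (\<lambda>n. (1/4::real) ^ Suc n)" by (simp add: summable_geometric)
  have sm: "summable (\<lambda>n. measure ?P (?B n))"
    by (rule summable_comparison_test'[OF geo, of 0]) (use B(2) in auto)
  have "measure ?P (\<Union>n. ?B n) \<le> (\<Sum>n. measure ?P (?B n))"
    by (rule finite_measure_subadditive_countably[OF image_subsetI[OF B(1)] sm])
  also have "\<dots> \<le> (\<Sum>n. (1/4::real) ^ Suc n)" by (rule suminf_le[OF B(2) sm geo])
  also have "\<dots> = 1/4 * (\<Sum>n. (1/4::real) ^ n)"
    by (subst suminf_mult[symmetric]) (auto simp: summable_geometric)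
  also have "\<dots> < 1" by (simp add: suminf_geometric)
  finally have "measure ?P (\<Union>n. ?B n) < 1" .
  moreover have "space ?P - (\<Union>n. ?B n) \<subseteq> perc_infinite (hierarchy \<alpha>) z"
  proof
    fix \<eta> assume \<eta>: "\<eta> \<in> space ?P - (\<Union>n. ?B n)"
    have "\<not> bad \<alpha> \<eta> (fst (label \<alpha> n z)) {snd (label \<alpha> n z)}" for n
    proof
      assume "bad \<alpha> \<eta> (fst (label \<alpha> n z)) {snd (label \<alpha> n z)}"
      with DiffD1[OF \<eta>] have "\<eta> \<in> ?B n" by (intro CollectI conjI)
      then have "\<eta> \<in> (\<Union>n. ?B n)" by (rule UN_I[OF UNIV_I])
      then show False by (rule DiffD2[OF \<eta>])
    qed
    then have "infinite (cluster_of {e \<in> hierarchy \<alpha>. \<eta> e} z)"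
      by (rule infinite_open_cluster[where \<alpha> = \<alpha> and \<eta> = \<eta> and z = z, OF aut])
    with DiffD1[OF \<eta>] show "\<eta> \<in> perc_infinite (hierarchy \<alpha>) z"
      unfolding perc_infinite_def by (intro CollectI conjI)
  qed
  then have "measure ?P (space ?P - (\<Union>n. ?B n)) \<le> measure ?P (perc_infinite (hierarchy \<alpha>) z)"
    by (intro finite_measure_mono sets_perc_infinite hierarchy_subset)
  moreover have "measure ?P (space ?P - (\<Union>n. ?B n)) = 1 - measure ?P (\<Union>n. ?B n)"
    by (rule prob_compl[OF sets.countable_UN[OF image_subsetI[OF B(1)]]])
  ultimately show ?thesis by linarith
qed

section \<open>From percolation on the slab edges to robust clusters\<close>

lemma cluster_of_step: "y \<in> cluster_of F v \<Longrightarrow> {y, z} \<in> F \<Longrightarrow> z \<in> cluster_of F v"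
  unfolding cluster_of_def by (auto intro: rtrancl_into_rtrancl)

text \<open>Percolation on the edges of the cluster is the restriction of percolation on all slab
  edges, and an open path from \<open>v\<close> in \<open>F\<close> uses only edges of the cluster
  of \<open>v\<close>. The \<open>\<epsilon>\<close> in the definition of \<open>robust\<close> is
  \<open>closed_prob\<close>.\<close>

lemma robustI:
  assumes F: "F \<subseteq> slab_edges" and pos: "measure (perc slab_edges) (perc_infinite F v) > 0"
  shows "robust F (cluster_of F v)"
proof -
  let ?J = "cluster_edges F (cluster_of F v)"
  let ?P = "perc slab_edges"
  have JF: "?J \<subseteq> F" by (auto simp: cluster_edges_def)
  then have J: "?J \<subseteq> slab_edges" using F by blast
  let ?E = "{\<eta> \<in> space (perc ?J). \<exists>v. infinite (cluster_of {e \<in> ?J. \<eta> e} v)}"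
  have E: "?E \<in> sets (perc ?J)"
      by (rule predE[OF pred_intros_countable(2)[OF measurable_cluster(2)[OF pred_perc_edge[OF subset_refl]]]])
  have restr: "(\<lambda>\<eta>. restrict \<eta> ?J) \<in> measurable ?P (perc ?J)"
    unfolding perc_def by (rule measurable_restrict_subset[OF J])
  \<comment> \<open>Restriction is written as reindexing along the identity, so that the marginal
    law follows from the general reindexing of product measures.\<close>
  have "distr ?P (perc ?J) (\<lambda>\<eta>. \<lambda>e\<in>?J. \<eta> (id e)) = perc ?J"
    unfolding perc_def by (rule distr_PiM_reindex) (use J in \<open>auto simp: prob_space_measure_pmf\<close>)
  then have "distr ?P (perc ?J) (\<lambda>\<eta>. restrict \<eta> ?J) = perc ?J" by (simp only: id_apply)
  then have "measure (perc ?J) ?E = measure ?P ((\<lambda>\<eta>. restrict \<eta> ?J) -` ?E \<inter> space ?P)"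
    using measure_distr[OF restr E] by simp
  also have "\<dots> \<ge> measure ?P (perc_infinite F v)"
  proof (rule finite_measure.finite_measure_mono)
    show "finite_measure ?P" using prob_space_perc prob_space.finite_measure by blast
    show "(\<lambda>\<eta>. restrict \<eta> ?J) -` ?E \<inter> space ?P \<in> sets ?P" using restr E by (rule measurable_sets)
    show "perc_infinite F v \<subseteq> (\<lambda>\<eta>. restrict \<eta> ?J) -` ?E \<inter> space ?P"
    proof
      fix \<eta> assume \<eta>: "\<eta> \<in> perc_infinite F v"
      have sub: "cluster_of {e \<in> F. \<eta> e} v \<subseteq> cluster_of {e \<in> ?J. restrict \<eta> ?J e} v"
      proof
        fix w assume "w \<in> cluster_of {e \<in> F. \<eta> e} v"
        then have "(v, w) \<in> {(a, b). {a, b} \<in> {e \<in> F. \<eta> e}}\<^sup>*" by (simp add: cluster_of_def)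
        \<comment> \<open>The second conjunct keeps the path inside the cluster of \<open>v\<close>
          in \<open>F\<close>, so that its next edge belongs to \<open>?J\<close>.\<close>
        then have "w \<in> cluster_of {e \<in> ?J. restrict \<eta> ?J e} v \<and> w \<in> cluster_of F v"
        proof induction
          case (step y z)
          then have y: "y \<in> cluster_of F v" and yz: "{y, z} \<in> F" "\<eta> {y, z}" by auto
          have z: "z \<in> cluster_of F v" using yz(1) y cluster_of_step by blast
          then have "{y, z} \<in> {e \<in> ?J. restrict \<eta> ?J e}"
            using y yz by (auto simp: cluster_edges_def)
          then have "z \<in> cluster_of {e \<in> ?J. restrict \<eta> ?J e} v"
            using step.IH cluster_of_step by blast
          then show ?case using z ..
        qed (simp add: cluster_of_def)
        then show "w \<in> cluster_of {e \<in> ?J. restrict \<eta> ?J e} v" ..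
      qed
      have \<eta>': "infinite (cluster_of {e \<in> F. \<eta> e} v)" "\<eta> \<in> space ?P"
        using \<eta> by (simp_all add: perc_infinite_def)
      have "infinite (cluster_of {e \<in> ?J. restrict \<eta> ?J e} v)"
        by (rule infinite_super[OF sub \<eta>'(1)])
      with measurable_space[OF restr \<eta>'(2)] have "restrict \<eta> ?J \<in> ?E"
        by (intro CollectI conjI exI)
      with \<eta>'(2) show "\<eta> \<in> (\<lambda>\<eta>. restrict \<eta> ?J) -` ?E \<inter> space ?P"
        by (intro IntI vimageI2)
    qed
  qed
  finally have "measure (perc ?J) ?E > 0" using pos by linarith
  then show ?thesis
    unfolding robust_def Let_def perc_def using closed_prob_bounds(1) by blast
qed

lemma infinite_clusters:
  assumes "\<And>xs. \<exists>v. \<forall>x\<in>set xs. v \<notin> cluster_of F x"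
  shows "infinite (clusters F)"
proof
  assume "finite (clusters F)"
  then obtain V where "finite V" "clusters F = cluster_of F ` V"
    unfolding clusters_def by (meson finite_range_imageI finite_subset_image subset_UNIV order_refl)
  then obtain xs where xs: "clusters F = cluster_of F ` set xs" by (metis finite_list)
  obtain v where v: "\<forall>x\<in>set xs. v \<notin> cluster_of F x" using assms by blast
  have "v \<in> cluster_of F v" by (simp add: cluster_of_def)
  moreover have "cluster_of F v \<in> cluster_of F ` set xs" unfolding xs[symmetric] by (simp add: clusters_def)
  ultimately show False using v by auto
qed

text \<open>A measurable condition which suffices for infinitely many robust clusters: one closing probability
  serves all clusters, and the percolation lives on all edges of the slab.\<close>

definition rich :: "edge set \<Rightarrow> bool" where
  "rich F \<longleftrightarrow> (\<forall>v. emeasure (perc slab_edges) (perc_infinite F v) > 0) \<and>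
     (\<forall>xs. \<exists>v. \<forall>x\<in>set xs. v \<notin> cluster_of F x)"

lemma rich_hierarchy:
  assumes "\<And>n. slab_aut (\<alpha> n)"
  shows "rich (hierarchy \<alpha>)"
  unfolding rich_def
  using hierarchy_percolates[where \<alpha> = \<alpha>, OF assms] hierarchy_new_cluster[where \<alpha> = \<alpha>, OF assms]
  by (auto simp: emeasure_eq_measure2 measure_def enn2real_positive_iff)

lemma rich_robust_clusters:
  assumes "F \<subseteq> slab_edges" "rich F"
  shows "infinite {C \<in> clusters F. robust F C}"
proof -
  interpret prob_space "perc slab_edges" by (rule prob_space_perc)
  have "robust F C" if "C \<in> clusters F" for C
    using that assms robustI by (auto simp: clusters_def rich_def emeasure_eq_measure)
  then have "{C \<in> clusters F. robust F C} = clusters F" by blast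
  then show ?thesis using infinite_clusters assms(2) by (simp add: rich_def)
qed

section \<open>Measurability of richness\<close>

lemma space_config_space: "space config_space = Pow slab_edges"
  unfolding config_space_def by (rule space_measure_of) auto

lemma sets_config_space_edge: "{F \<in> space config_space. e \<in> F} \<in> sets config_space"
proof (cases "e \<in> slab_edges")
  case True
  have "sets config_space = sigma_sets (Pow slab_edges) {{\<omega> \<in> Pow slab_edges. e \<in> \<omega>} | e. e \<in> slab_edges}"
    unfolding config_space_def by (rule sets_measure_of) auto
  then show ?thesis unfolding space_config_space
    using True by (simp only:) (rule sigma_sets.Basic, blast)
next
  case False
  then have "{F \<in> space config_space. e \<in> F} = {}" by (auto simp: space_config_space)
  then show ?thesis by (rule ssubst) (rule sets.empty_sets)
qed

text \<open>The event of an infinite open cluster is jointly measurable in \<open>F\<close> and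
  \<open>\<eta>\<close>, so the measure of its section at \<open>F\<close> is measurable in
  \<open>F\<close>. The remaining quantifiers range over countable types.\<close>

lemma measurable_rich: "{F \<in> space config_space. rich F} \<in> sets config_space"
proof -
  let ?P = "perc slab_edges"
  interpret prob_space ?P by (rule prob_space_perc)
  have edge[measurable]: "Measurable.pred config_space (\<lambda>F. e \<in> F)" for e
    unfolding pred_def by (rule sets_config_space_edge)
  have "Measurable.pred (config_space \<Otimes>\<^sub>M ?P) (\<lambda>x. e \<in> {e \<in> fst x. snd x e})" for e
  proof (cases "e \<in> slab_edges")
    case True
    show ?thesis unfolding mem_Collect_eq
      by (intro pred_intros_logic(3) measurable_compose[OF measurable_fst edge]
          measurable_compose[OF measurable_snd measurable_perc[OF True]])
  next
    case False
    \<comment> \<open>Outside the slab edges \<open>\<eta> e\<close> is no coordinate of the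
      product, but there \<open>e\<close> is never in \<open>F\<close>.\<close>
    then have "x \<in> space (config_space \<Otimes>\<^sub>M ?P) \<Longrightarrow> (e \<in> {e \<in> fst x. snd x e}) = False" for x
      by (auto simp: space_pair_measure space_config_space)
    then have "?thesis \<longleftrightarrow> Measurable.pred (config_space \<Otimes>\<^sub>M ?P) (\<lambda>_. False)"
      by (rule measurable_cong)
    then show ?thesis by (rule iffD2) (rule measurable_const, simp)
  qed
  note joint = measurable_cluster(2)[OF this]
  have pos: "Measurable.pred config_space (\<lambda>F. 0 < f F)"
    if [measurable]: "f \<in> borel_measurable config_space" for f :: "edge set \<Rightarrow> ennreal"
    by measurable
  have meas: "(\<lambda>F. emeasure ?P (perc_infinite F v)) \<in> borel_measurable config_space" for v
  proof -
    let ?Q = "{x \<in> space (config_space \<Otimes>\<^sub>M ?P). infinite (cluster_of {e \<in> fst x. snd x e} v)}"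
    have "?Q \<in> sets (config_space \<Otimes>\<^sub>M ?P)" by (rule predE[OF joint])
    then have "(\<lambda>F. emeasure ?P (Pair F -` ?Q)) \<in> borel_measurable config_space"
      by (rule measurable_emeasure_Pair)
    moreover have "emeasure ?P (Pair F -` ?Q) = emeasure ?P (perc_infinite F v)"
      if "F \<in> space config_space" for F
    proof -
      have "Pair F -` ?Q = perc_infinite F v"
        using that by (auto simp: perc_infinite_def space_pair_measure)
      then show ?thesis by (rule arg_cong)
    qed
    ultimately show ?thesis by (rule iffD1[OF measurable_cong, rotated])
  qed

  have cl: "Measurable.pred config_space (\<lambda>F. w \<in> cluster_of F v)" for v w
    by (rule measurable_cluster(1)[where G = "\<lambda>F. F", OF edge])
  have "Measurable.pred config_space (\<lambda>F. \<exists>v. \<forall>x\<in>set xs. v \<notin> cluster_of F x)" for xs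
    by (intro pred_intros_countable(2) pred_intros_finite(3) pred_intros_logic(2) cl) simp
  moreover have "Measurable.pred config_space (\<lambda>F. 0 < emeasure ?P (perc_infinite F v))" for v
    by (rule pos[OF meas])
  ultimately show ?thesis
    unfolding rich_def by (intro predE pred_intros_logic(3) pred_intros_countable(1))
qed

section \<open>The random environment\<close>

text \<open>The quotient of \<open>\<psi>\<close> modulo \<open>16 Z^2\<close>:
  \<open>\<psi>\<close> is \<open>aut_rep \<psi>\<close> followed by the translation by 16 times
  this vector.\<close>

definition carry :: "(vtx \<Rightarrow> vtx) \<Rightarrow> int \<times> int" where
  "carry \<psi> = (case \<psi> (0, 0, False) of (x, y, b) \<Rightarrow> (x div 16, y div 16))"

definition aut_rep :: "(vtx \<Rightarrow> vtx) \<Rightarrow> vtx \<Rightarrow> vtx" where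
  "aut_rep \<psi> = (case carry \<psi> of (p, q) \<Rightarrow> translate (- 16 * p, - 16 * q) \<circ> \<psi>)"

lemma aut_rep_in: "slab_aut \<psi> \<Longrightarrow> aut_rep \<psi> \<in> aut_reps"
  by (auto simp: aut_rep_def aut_reps_def carry_def translate_aut slab_aut_comp translate_def
      fundamental_box_def minus_mult_div_eq_mod[symmetric] split: prod.splits)

text \<open>By periodicity, replacing \<open>\<psi>\<close> by its representative leaves the choice
  of the coarse slab unchanged and only translates inside it.\<close>

lemma coarse_aut_rep:
  "coarse (\<psi> u) = (fst (coarse (aut_rep \<psi> u)), translate (carry \<psi>) (snd (coarse (aut_rep \<psi> u))))"
proof -
  obtain p q where pq: "carry \<psi> = (p, q)" by (cases "carry \<psi>")
  have "\<psi> u = translate (16 * p, 16 * q) (aut_rep \<psi> u)"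
    by (simp add: aut_rep_def pq translate_translate translate_0)
  then show ?thesis by (simp add: coarse_translate pq)
qed

text \<open>Equal representatives force \<open>\<alpha>\<close> and \<open>\<beta>\<close> to differ
  by a translation in \<open>16 Z^2\<close>, which is trivial because both send the origin into the
  box.\<close>

lemma aut_rep_inj:
  assumes "\<alpha> \<in> aut_reps" "\<beta> \<in> aut_reps" and \<psi>: "slab_aut \<psi>"
    and eq: "aut_rep (\<alpha> \<circ> \<psi>) = aut_rep (\<beta> \<circ> \<psi>)"
  shows "\<alpha> = \<beta>"
proof -
  obtain p q where a: "carry (\<alpha> \<circ> \<psi>) = (p, q)" by fastforce
  obtain p' q' where b: "carry (\<beta> \<circ> \<psi>) = (p', q')" by fastforce
  have *: "\<alpha> u = translate (16 * (p - p'), 16 * (q - q')) (\<beta> u)" for u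
  proof -
    obtain z where z: "u = \<psi> z" using slab_aut_bij[OF \<psi>] by (metis bij_pointE)
    have "translate (16 * p, 16 * q) (aut_rep (\<alpha> \<circ> \<psi>) z) = \<alpha> u"
      by (simp add: aut_rep_def a translate_translate translate_0 z)
    moreover have "aut_rep (\<beta> \<circ> \<psi>) z = translate (- 16 * p', - 16 * q') (\<beta> u)"
      by (simp add: aut_rep_def b z)
    ultimately show ?thesis unfolding eq by (simp add: translate_translate algebra_simps)
  qed
  obtain x y c where x: "\<alpha> (0, 0, False) = (x, y, c)" by (cases "\<alpha> (0, 0, False)")
  obtain x' y' c' where x': "\<beta> (0, 0, False) = (x', y', c')" by (cases "\<beta> (0, 0, False)")
  have "0 \<le> x" "x < 16" "0 \<le> y" "y < 16" "0 \<le> x'" "x' < 16" "0 \<le> y'" "y' < 16"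
    using assms(1,2) x x' by (auto simp: aut_reps_def fundamental_box_def)
  moreover have "x = x' + 16 * (p - p')" "y = y' + 16 * (q - q')"
    using *[of "(0, 0, False)"] x x' by (auto simp: translate_def)
  ultimately have "p = p'" "q = q'" by simp_all
  then show ?thesis using * by (simp add: fun_eq_iff translate_0)
qed

text \<open>An injective self-map of a finite set is onto: right composition with
  \<open>\<psi>\<close> permutes the classes.\<close>

lemma aut_rep_surj:
  assumes \<psi>: "slab_aut \<psi>" and "\<beta> \<in> aut_reps"
  shows "\<exists>\<alpha>\<in>aut_reps. aut_rep (\<alpha> \<circ> \<psi>) = \<beta>"
proof -
  let ?f = "\<lambda>\<alpha>. aut_rep (\<alpha> \<circ> \<psi>)"
  have "inj_on ?f aut_reps" using aut_rep_inj[OF _ _ \<psi>] by (auto intro: inj_onI)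
  moreover have "?f ` aut_reps \<subseteq> aut_reps"
  proof (rule image_subsetI)
    fix \<alpha> assume "\<alpha> \<in> aut_reps"
    then have "slab_aut \<alpha>" by (simp add: aut_reps_def)
    then show "?f \<alpha> \<in> aut_reps" by (intro aut_rep_in slab_aut_comp \<psi>)
  qed
  ultimately have "?f ` aut_reps = aut_reps" by (intro endo_inj_surj[OF finite_aut_reps])
  then have "\<beta> \<in> ?f ` aut_reps" using assms(2) by (simp only:)
  then obtain \<alpha> where "\<alpha> \<in> aut_reps" "\<beta> = aut_rep (\<alpha> \<circ> \<psi>)" by (rule imageE)
  then show ?thesis by (intro bexI[of _ \<alpha>]) (simp_all only:)
qed

text \<open>Moving the slab by \<open>\<phi>\<close> changes the environment by an automaton which reads the automorphisms
  \<open>\<alpha> 0, \<alpha> 1, \<dots>\<close>; its states are \<open>\<phi>\<close> and translations, passed on like the carry in an addition.\<close>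

primrec state :: "(vtx \<Rightarrow> vtx) \<Rightarrow> (nat \<Rightarrow> vtx \<Rightarrow> vtx) \<Rightarrow> nat \<Rightarrow> vtx \<Rightarrow> vtx" where
  "state \<phi> \<alpha> 0 = \<phi>"
| "state \<phi> \<alpha> (Suc n) = translate (carry (\<alpha> n \<circ> state \<phi> \<alpha> n))"

definition act :: "(vtx \<Rightarrow> vtx) \<Rightarrow> (nat \<Rightarrow> vtx \<Rightarrow> vtx) \<Rightarrow> nat \<Rightarrow> vtx \<Rightarrow> vtx" where
  "act \<phi> \<alpha> n = aut_rep (\<alpha> n \<circ> state \<phi> \<alpha> n)"

lemma state_aut: "slab_aut \<phi> \<Longrightarrow> slab_aut (state \<phi> \<alpha> n)"
  by (cases n) (simp_all add: translate_aut)

lemma state_cong: "(\<And>i. i < n \<Longrightarrow> \<alpha> i = \<beta> i) \<Longrightarrow> state \<phi> \<alpha> n = state \<phi> \<beta> n"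
  by (induction n) auto

lemma act_cong: "(\<And>i. i \<le> n \<Longrightarrow> \<alpha> i = \<beta> i) \<Longrightarrow> act \<phi> \<alpha> n = act \<phi> \<beta> n"
  unfolding act_def using state_cong[of n \<alpha> \<beta>] by simp

lemma act_in: "slab_aut \<phi> \<Longrightarrow> (\<And>n. \<alpha> n \<in> aut_reps) \<Longrightarrow> act \<phi> \<alpha> n \<in> aut_reps"
  unfolding act_def by (intro aut_rep_in slab_aut_comp state_aut) (auto simp: aut_reps_def)

text \<open>By induction: \<open>\<alpha> n\<close> after the current state equals
  \<open>act \<phi> \<alpha> n\<close> followed by a translation by 16 times the carry, and
  coarsening turns that into the translation by the carry, which is the next state.\<close>

lemma label_act:
  "label \<alpha> n (\<phi> u) = (fst (label (act \<phi> \<alpha>) n u), state \<phi> \<alpha> n (snd (label (act \<phi> \<alpha>) n u)))"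
proof (induction n)
  case (Suc n)
  obtain w v where "label (act \<phi> \<alpha>) n u = (w, v)" by (cases "label (act \<phi> \<alpha>) n u")
  moreover have "coarse (\<alpha> n (state \<phi> \<alpha> n v)) =
      (fst (coarse (act \<phi> \<alpha> n v)), translate (carry (\<alpha> n \<circ> state \<phi> \<alpha> n)) (snd (coarse (act \<phi> \<alpha> n v))))"
    using coarse_aut_rep[of "\<alpha> n \<circ> state \<phi> \<alpha> n" v] by (simp add: act_def)
  ultimately show ?case
    using Suc by (cases "coarse (act \<phi> \<alpha> n v)") simp
qed simp

text \<open>The states are injective, so whether two labels agree is the same in both
  environments.\<close>

lemma hierarchy_act:
  assumes "slab_aut \<phi>"
  shows "{u, v} \<in> hierarchy (act \<phi> \<alpha>) \<longleftrightarrow> {\<phi> u, \<phi> v} \<in> hierarchy \<alpha>"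
proof -
  have "label \<alpha> n (\<phi> u) = label \<alpha> n (\<phi> v) \<longleftrightarrow> label (act \<phi> \<alpha>) n u = label (act \<phi> \<alpha>) n v" for n
    by (cases "label (act \<phi> \<alpha>) n u"; cases "label (act \<phi> \<alpha>) n v")
      (simp add: label_act slab_aut_eq[OF state_aut[OF assms]])
  then show ?thesis by (simp add: hierarchy_iff slab_aut_adj[OF assms])
qed

lemma image_hierarchy:
  assumes \<phi>: "slab_aut \<phi>"
  shows "(\<lambda>e. \<phi> ` e) ` hierarchy \<alpha> = hierarchy (act (inv \<phi>) \<alpha>)"
proof (intro set_eqI iffI)
  have inv: "inv \<phi> (\<phi> u) = u" "\<phi> (inv \<phi> u) = u" for u
    using slab_aut_bij[OF \<phi>] by (simp_all add: bij_is_inj bij_is_surj surj_f_inv_f)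
  note act = hierarchy_act[OF slab_aut_inv[OF \<phi>], of _ _ \<alpha>]
  fix e
  {
    assume "e \<in> (\<lambda>e. \<phi> ` e) ` hierarchy \<alpha>"
    then obtain e' where e': "e' \<in> hierarchy \<alpha>" "e = \<phi> ` e'" by blast
    then obtain u v where "e' = {u, v}" using hierarchy_subset slab_edgeE by blast
    then show "e \<in> hierarchy (act (inv \<phi>) \<alpha>)" using e' act[of "\<phi> u" "\<phi> v"] by (simp add: inv)
  }
  {
    assume e: "e \<in> hierarchy (act (inv \<phi>) \<alpha>)"
    then obtain u v where uv: "e = {u, v}" using hierarchy_subset slab_edgeE by blast
    then have "{inv \<phi> u, inv \<phi> v} \<in> hierarchy \<alpha>" using e act[of u v] by simp
    then show "e \<in> (\<lambda>e. \<phi> ` e) ` hierarchy \<alpha>"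
      by (rule rev_image_eqI) (simp add: uv inv)
  }
qed

section \<open>The product measure on environments and its invariance\<close>

definition env :: "(nat \<Rightarrow> vtx \<Rightarrow> vtx) measure" where
  "env = PiM UNIV (\<lambda>_. uniform_count_measure aut_reps)"

lemma id_in_aut_reps: "id \<in> aut_reps"
proof -
  have "translate (0, 0) = id" by (simp add: fun_eq_iff translate_0)
  then show ?thesis using translate_aut[of "(0, 0)"] by (simp add: aut_reps_def fundamental_box_def)
qed

lemma prob_space_reps: "prob_space (uniform_count_measure aut_reps)"
  using finite_aut_reps id_in_aut_reps by (intro prob_space_uniform_count_measure) auto

lemma prob_space_env: "prob_space env"
  unfolding env_def by (intro prob_space_PiM prob_space_reps)

lemma space_env: "\<alpha> \<in> space env \<longleftrightarrow> (\<forall>n. \<alpha> n \<in> aut_reps)"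
  by (auto simp: env_def space_PiM space_uniform_count_measure PiE_def)

lemma env_aut: "\<alpha> \<in> space env \<Longrightarrow> slab_aut (\<alpha> n)"
  by (simp add: space_env aut_reps_def)

definition cyl :: "nat \<Rightarrow> (nat \<Rightarrow> vtx \<Rightarrow> vtx) \<Rightarrow> (nat \<Rightarrow> vtx \<Rightarrow> vtx) set" where
  "cyl m \<beta> = {\<alpha> \<in> space env. \<forall>i\<in>{..<m}. \<alpha> i \<in> {\<beta> i}}"

lemma
  assumes "\<And>i. \<beta> i \<in> aut_reps"
  shows sets_cyl: "cyl m \<beta> \<in> sets env"
    and emeasure_cyl: "emeasure env (cyl m \<beta>) = ennreal (1 / real (card aut_reps)) ^ m"
proof -
  let ?U = "uniform_count_measure aut_reps"
  interpret product_prob_space "\<lambda>_::nat. ?U" UNIV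
    by (simp add: product_prob_spaceI prob_space_reps)
  show "cyl m \<beta> \<in> sets env"
    unfolding cyl_def
  proof (intro sets.sets_Collect_finite_All)
    fix i
    have "(\<lambda>\<alpha>. \<alpha> i) \<in> measurable env ?U" unfolding env_def by (rule measurable_component_singleton) simp
    then have "(\<lambda>\<alpha>. \<alpha> i) -` {\<beta> i} \<inter> space env \<in> sets env"
      by (rule measurable_sets) (simp add: sets_uniform_count_measure assms)
    moreover have "(\<lambda>\<alpha>. \<alpha> i) -` {\<beta> i} \<inter> space env = {\<alpha> \<in> space env. \<alpha> i \<in> {\<beta> i}}" by auto
    ultimately show "{\<alpha> \<in> space env. \<alpha> i \<in> {\<beta> i}} \<in> sets env" by (simp only:)
  qed simp
  have "emeasure env (cyl m \<beta>) = (\<Prod>i<m. emeasure ?U {\<beta> i})"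
    unfolding env_def cyl_def
    by (rule emeasure_PiM_Collect) (auto simp: sets_uniform_count_measure assms)
  also have "\<dots> = ennreal (1 / real (card aut_reps)) ^ m"
    using assms finite_aut_reps by (simp add: emeasure_uniform_count_measure)
  finally show "emeasure env (cyl m \<beta>) = ennreal (1 / real (card aut_reps)) ^ m" .
qed

text \<open>Padding with \<open>id\<close> from \<open>m\<close> on gives each cylinder of length
  \<open>m\<close> a single code, so there are finitely many codes and their cylinders are
  disjoint.\<close>

definition cylinder_codes :: "nat \<Rightarrow> ((nat \<Rightarrow> vtx \<Rightarrow> vtx) \<Rightarrow> bool) \<Rightarrow> (nat \<Rightarrow> vtx \<Rightarrow> vtx) set" where
  "cylinder_codes m P = {\<beta> \<in> space env. (\<forall>i\<ge>m. \<beta> i = id) \<and> P \<beta>}"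

lemma finite_cylinder_codes: "finite (cylinder_codes m P)"
proof -
  have "inj_on (\<lambda>\<beta>. restrict \<beta> {..<m}) (cylinder_codes m P)"
  proof (rule inj_onI)
    fix \<beta> \<gamma> assume *: "\<beta> \<in> cylinder_codes m P" "\<gamma> \<in> cylinder_codes m P"
      "restrict \<beta> {..<m} = restrict \<gamma> {..<m}"
    show "\<beta> = \<gamma>"
    proof
      fix i show "\<beta> i = \<gamma> i"
        by (cases "i < m") (use fun_cong[OF *(3), of i] in simp, use *(1,2) in \<open>simp add: cylinder_codes_def\<close>)
    qed
  qed
  moreover have "(\<lambda>\<beta>. restrict \<beta> {..<m}) ` cylinder_codes m P \<subseteq> Pi\<^sub>E {..<m} (\<lambda>_. aut_reps)"
    by (auto simp: cylinder_codes_def space_env)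
  moreover have "finite (Pi\<^sub>E {..<m} (\<lambda>_. aut_reps))" by (intro finite_PiE finite_aut_reps) simp
  ultimately show ?thesis by (meson finite_imageD finite_subset)
qed

lemma cylinder_decomposition:
  assumes dep: "\<And>\<alpha> \<beta>. \<alpha> \<in> space env \<Longrightarrow> \<beta> \<in> space env \<Longrightarrow> (\<And>i. i < m \<Longrightarrow> \<alpha> i = \<beta> i) \<Longrightarrow> P \<alpha> \<Longrightarrow> P \<beta>"
  shows "{\<alpha> \<in> space env. P \<alpha>} = (\<Union>\<beta>\<in>cylinder_codes m P. cyl m \<beta>)" (is "?L = ?R")
proof (intro set_eqI iffI)
  fix \<alpha> assume \<alpha>: "\<alpha> \<in> ?L"
  let ?\<beta> = "\<lambda>i. if i < m then \<alpha> i else id"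
  have "?\<beta> \<in> space env" using \<alpha> id_in_aut_reps by (auto simp: space_env)
  then have "?\<beta> \<in> cylinder_codes m P" using \<alpha> dep[of \<alpha> ?\<beta>] by (auto simp: cylinder_codes_def)
  moreover have "\<alpha> \<in> cyl m ?\<beta>" using \<alpha> by (auto simp: cyl_def)
  ultimately show "\<alpha> \<in> ?R" by blast
next
  fix \<alpha> assume "\<alpha> \<in> ?R"
  then obtain \<beta> where "\<beta> \<in> cylinder_codes m P" "\<alpha> \<in> cyl m \<beta>" by blast
  then show "\<alpha> \<in> ?L" using dep[of \<beta> \<alpha>] by (auto simp: cylinder_codes_def cyl_def)
qed

lemma cylinder_codes_in: "\<beta> \<in> cylinder_codes m P \<Longrightarrow> \<beta> i \<in> aut_reps"
  by (simp add: cylinder_codes_def space_env)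

lemma sets_cyl_code: "\<beta> \<in> cylinder_codes m P \<Longrightarrow> cyl n \<beta> \<in> sets env"
  by (rule sets_cyl) (rule cylinder_codes_in)

lemma disjoint_cyls: "disjoint_family_on (cyl m) (cylinder_codes m P)"
proof -
  have "\<beta> = \<gamma>" if "\<beta> \<in> cylinder_codes m P" "\<gamma> \<in> cylinder_codes m P" "\<alpha> \<in> cyl m \<beta>" "\<alpha> \<in> cyl m \<gamma>" for \<alpha> \<beta> \<gamma>
  proof
    fix i show "\<beta> i = \<gamma> i"
      using that by (cases "i < m") (auto simp: cylinder_codes_def cyl_def)
  qed
  then show ?thesis unfolding disjoint_family_on_def by blast
qed

lemma sets_env_finite_dependence:
  assumes "\<And>\<alpha> \<beta>. \<alpha> \<in> space env \<Longrightarrow> \<beta> \<in> space env \<Longrightarrow> (\<And>i. i < m \<Longrightarrow> \<alpha> i = \<beta> i) \<Longrightarrow> P \<alpha> \<Longrightarrow> P \<beta>"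
  shows "{\<alpha> \<in> space env. P \<alpha>} \<in> sets env"
proof -
  have "{\<alpha> \<in> space env. P \<alpha>} = (\<Union>\<beta>\<in>cylinder_codes m P. cyl m \<beta>)"
    using assms by (rule cylinder_decomposition)
  also have "\<dots> \<in> sets env"
    by (intro sets.finite_UN finite_cylinder_codes sets_cyl_code)
  finally show ?thesis .
qed

text \<open>The automaton reads from left to right. Once the first \<open>m\<close> inputs are
  fixed, so is the state, and the map from input \<open>m\<close> to output \<open>m\<close> is a
  bijection of \<open>aut_reps\<close>. So the preimage of a cylinder is a cylinder of the same
  length.\<close>

lemma act_cyl:
  assumes \<phi>: "slab_aut \<phi>" and \<beta>: "\<And>i. \<beta> i \<in> aut_reps"
  shows "\<exists>\<gamma>. (\<forall>i. \<gamma> i \<in> aut_reps) \<and> act \<phi> -` cyl m \<beta> \<inter> space env = cyl m \<gamma>"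
proof (induction m)
  case 0
  have "act \<phi> -` cyl 0 \<beta> \<inter> space env = cyl 0 \<beta>"
    using act_in[OF \<phi>] by (auto simp: cyl_def space_env)
  then show ?case using \<beta> by blast
next
  case (Suc m)
  then obtain \<gamma> where \<gamma>: "\<forall>i. \<gamma> i \<in> aut_reps" "act \<phi> -` cyl m \<beta> \<inter> space env = cyl m \<gamma>" by blast
  \<comment> \<open>The input at \<open>m\<close> that produces the output \<open>\<beta> m\<close>
    from the state reached along \<open>\<gamma>\<close>.\<close>
  obtain x where x: "x \<in> aut_reps" "aut_rep (x \<circ> state \<phi> \<gamma> m) = \<beta> m"
    using aut_rep_surj[OF state_aut[OF \<phi>] \<beta>] by blast
  have cyl_Suc: "\<alpha> \<in> cyl (Suc m) \<delta> \<longleftrightarrow> \<alpha> \<in> cyl m \<delta> \<and> \<alpha> m = \<delta> m" for \<alpha> \<delta>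
    by (auto simp: cyl_def less_Suc_eq)
  have cyl_upd: "cyl m (\<gamma>(m := x)) = cyl m \<gamma>" by (auto simp: cyl_def)
  have "\<alpha> \<in> act \<phi> -` cyl (Suc m) \<beta> \<inter> space env \<longleftrightarrow> \<alpha> \<in> cyl (Suc m) (\<gamma>(m := x))" for \<alpha>
  proof -
    have "act \<phi> \<alpha> m = \<beta> m \<longleftrightarrow> \<alpha> m = x" if \<alpha>: "\<alpha> \<in> cyl m \<gamma>"
    proof -
      have st: "state \<phi> \<alpha> m = state \<phi> \<gamma> m" using \<alpha> by (intro state_cong) (auto simp: cyl_def)
      have "\<alpha> m \<in> aut_reps" using \<alpha> by (auto simp: cyl_def space_env)
      then show ?thesis
        using x aut_rep_inj[OF _ _ state_aut[OF \<phi>], of "\<alpha> m" x \<gamma> m] unfolding act_def st by metis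
    qed
    then show ?thesis
      using \<gamma>(2) unfolding cyl_Suc cyl_upd by (auto simp: cyl_Suc)
  qed
  then have "act \<phi> -` cyl (Suc m) \<beta> \<inter> space env = cyl (Suc m) (\<gamma>(m := x))" by blast
  moreover have "\<forall>i. (\<gamma>(m := x)) i \<in> aut_reps" using \<gamma>(1) x(1) by simp
  ultimately show ?case by blast
qed

lemma measurable_act:
  assumes \<phi>: "slab_aut \<phi>"
  shows "act \<phi> \<in> measurable env env"
proof -
  have "(\<lambda>\<alpha>. act \<phi> \<alpha> i) \<in> measurable env (uniform_count_measure aut_reps)" for i
  proof (rule measurableI)
    fix \<alpha> assume "\<alpha> \<in> space env"
    then show "act \<phi> \<alpha> i \<in> space (uniform_count_measure aut_reps)"
      using act_in[OF \<phi>] by (simp add: space_env space_uniform_count_measure)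
  next
    fix A assume "A \<in> sets (uniform_count_measure aut_reps)"
    have "{\<alpha> \<in> space env. act \<phi> \<alpha> i \<in> A} \<in> sets env"
    proof (rule sets_env_finite_dependence)
      fix \<alpha> \<beta> assume "\<And>j. j < Suc i \<Longrightarrow> \<alpha> j = \<beta> j" "act \<phi> \<alpha> i \<in> A"
      then show "act \<phi> \<beta> i \<in> A" using act_cong[of i \<alpha> \<beta> \<phi>] by simp
    qed
    moreover have "(\<lambda>\<alpha>. act \<phi> \<alpha> i) -` A \<inter> space env = {\<alpha> \<in> space env. act \<phi> \<alpha> i \<in> A}" by auto
    ultimately show "(\<lambda>\<alpha>. act \<phi> \<alpha> i) -` A \<inter> space env \<in> sets env" by (simp only:)
  qed
  moreover have "act \<phi> \<in> space env \<rightarrow> (UNIV \<rightarrow>\<^sub>E space (uniform_count_measure aut_reps))"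
    using act_in[OF \<phi>] by (auto simp: space_env space_uniform_count_measure)
  ultimately show ?thesis
    unfolding env_def[symmetric] by (subst (2) env_def) (intro measurable_PiM_single', auto)
qed

text \<open>All cylinders of one length have the same measure, and taking preimages under
  \<open>act \<phi>\<close> preserves the length. Every finite-dimensional event is a finite
  disjoint union of cylinders.\<close>

lemma env_invariant:
  assumes \<phi>: "slab_aut \<phi>"
  shows "distr env env (act \<phi>) = env"
proof -
  let ?U = "\<lambda>_::nat. uniform_count_measure aut_reps"
  interpret prob_space env by (rule prob_space_env)
  note act = measurable_act[OF \<phi>]
  show ?thesis
  proof (rule measure_eqI_PiM_infinite[where I = UNIV and M = ?U])
    show "finite_measure (distr env env (act \<phi>))"
      using prob_space_distr[OF act] prob_space.finite_measure by blast
    fix A :: "nat \<Rightarrow> (vtx \<Rightarrow> vtx) set" and J :: "nat set"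
    assume J: "finite J" and A: "\<And>i. i \<in> J \<Longrightarrow> A i \<in> sets (?U i)"
    \<comment> \<open>The index set is enlarged to an initial segment, because the automaton is only
      controlled along initial segments.\<close>
    obtain m where m: "J \<subseteq> {..<m}" using J finite_nat_iff_bounded by blast
    let ?E = "prod_emb UNIV ?U J (Pi\<^sub>E J A)"
    have E: "?E \<in> sets env" unfolding env_def using J A by (intro sets_PiM_I) auto
    define P where "P \<alpha> \<longleftrightarrow> (\<forall>j\<in>J. \<alpha> j \<in> A j)" for \<alpha> :: "nat \<Rightarrow> vtx \<Rightarrow> vtx"
    have "?E = {\<alpha> \<in> space env. P \<alpha>}"
      unfolding prod_emb_def P_def env_def by (auto simp: space_PiM PiE_iff)
    also have "\<dots> = (\<Union>\<beta>\<in>cylinder_codes m P. cyl m \<beta>)"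
    proof (rule cylinder_decomposition)
      fix \<alpha> \<beta> assume "\<And>i. i < m \<Longrightarrow> \<alpha> i = \<beta> i" "P \<alpha>"
      then show "P \<beta>" using m unfolding P_def by (metis lessThan_iff subsetD)
    qed
    finally have E_eq: "?E = (\<Union>\<beta>\<in>cylinder_codes m P. cyl m \<beta>)" .
    have cyl: "cyl m ` cylinder_codes m P \<subseteq> sets env"
      by (intro image_subsetI sets_cyl_code)
    have pre: "act \<phi> -` cyl m \<beta> \<inter> space env \<in> sets env"
      "emeasure env (act \<phi> -` cyl m \<beta> \<inter> space env) = emeasure env (cyl m \<beta>)"
      if "\<beta> \<in> cylinder_codes m P" for \<beta>
    proof -
      note \<beta> = cylinder_codes_in[OF that]
      obtain \<gamma> where "\<forall>i. \<gamma> i \<in> aut_reps" "act \<phi> -` cyl m \<beta> \<inter> space env = cyl m \<gamma>"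
        using act_cyl[where \<beta> = \<beta>, OF \<phi> \<beta>] by blast
      then show "act \<phi> -` cyl m \<beta> \<inter> space env \<in> sets env"
        "emeasure env (act \<phi> -` cyl m \<beta> \<inter> space env) = emeasure env (cyl m \<beta>)"
        using sets_cyl emeasure_cyl[of \<gamma> m] emeasure_cyl[where \<beta> = \<beta> and m = m, OF \<beta>] by simp_all
    qed
    have "emeasure (distr env env (act \<phi>)) ?E = emeasure env (act \<phi> -` ?E \<inter> space env)"
      by (rule emeasure_distr[OF act E])
    also have "act \<phi> -` ?E \<inter> space env = (\<Union>\<beta>\<in>cylinder_codes m P. act \<phi> -` cyl m \<beta> \<inter> space env)"
      unfolding E_eq by blast
    also have "emeasure env \<dots> = (\<Sum>\<beta>\<in>cylinder_codes m P. emeasure env (act \<phi> -` cyl m \<beta> \<inter> space env))"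
    proof (rule sum_emeasure[symmetric])
      show "(\<lambda>\<beta>. act \<phi> -` cyl m \<beta> \<inter> space env) ` cylinder_codes m P \<subseteq> sets env"
        by (intro image_subsetI pre(1))
      show "disjoint_family_on (\<lambda>\<beta>. act \<phi> -` cyl m \<beta> \<inter> space env) (cylinder_codes m P)"
        using disjoint_cyls[of m P] unfolding disjoint_family_on_def by blast
    qed (rule finite_cylinder_codes)
    also have "\<dots> = (\<Sum>\<beta>\<in>cylinder_codes m P. emeasure env (cyl m \<beta>))"
      by (rule sum.cong[OF refl pre(2)])
    also have "\<dots> = emeasure env ?E"
      unfolding E_eq by (rule sum_emeasure[OF cyl disjoint_cyls finite_cylinder_codes])
    finally show "emeasure (distr env env (act \<phi>)) ?E = emeasure env ?E" .
  qed (simp_all add: env_def)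
qed

section \<open>The hierarchy as a random configuration, and its law\<close>

lemma label_cong: "(\<And>i. i < n \<Longrightarrow> \<alpha> i = \<beta> i) \<Longrightarrow> label \<alpha> n u = label \<beta> n u"
  by (induction n) (auto split: prod.splits)

lemma measurable_config_space:
  assumes "\<And>x. x \<in> space M \<Longrightarrow> f x \<subseteq> slab_edges"
    and "\<And>e. e \<in> slab_edges \<Longrightarrow> {x \<in> space M. e \<in> f x} \<in> sets M"
  shows "f \<in> measurable M config_space"
  unfolding config_space_def
proof (rule measurable_measure_of)
  fix Y assume "Y \<in> {{\<omega> \<in> Pow slab_edges. e \<in> \<omega>} | e. e \<in> slab_edges}"
  then obtain e where e: "e \<in> slab_edges" "Y = {\<omega> \<in> Pow slab_edges. e \<in> \<omega>}" by blast
  have "f -` Y \<inter> space M = {x \<in> space M. e \<in> f x}" using assms(1) e by auto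
  then show "f -` Y \<inter> space M \<in> sets M" using assms(2)[OF e(1)] by (simp only:)
qed (use assms(1) in auto)

text \<open>An edge is retained if the labels of its ends agree at some level, and labels at level
  \<open>n\<close> depend only on the first \<open>n\<close> automorphisms.\<close>

lemma measurable_hierarchy: "hierarchy \<in> measurable env config_space"
proof (rule measurable_config_space[OF hierarchy_subset])
  fix e assume "e \<in> slab_edges"
  then obtain u v where e: "e = {u, v}" "slab_adj u v" by (rule slab_edgeE)
  have eq: "{\<alpha> \<in> space env. e \<in> hierarchy \<alpha>} = (\<Union>n. {\<alpha> \<in> space env. label \<alpha> n u = label \<alpha> n v})"
    using e by (auto simp: hierarchy_iff)
  have "{\<alpha> \<in> space env. label \<alpha> n u = label \<alpha> n v} \<in> sets env" for n
  proof (rule sets_env_finite_dependence[where m = n])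
    fix \<alpha> \<beta> assume "\<And>i. i < n \<Longrightarrow> \<alpha> i = \<beta> i" "label \<alpha> n u = label \<alpha> n v"
    then show "label \<beta> n u = label \<beta> n v" using label_cong[of n \<alpha> \<beta>] by metis
  qed
  then show "{\<alpha> \<in> space env. e \<in> hierarchy \<alpha>} \<in> sets env"
    unfolding eq by (intro sets.countable_UN image_subsetI)
qed

lemma measurable_image_config:
  assumes \<phi>: "slab_aut \<phi>"
  shows "(\<lambda>\<omega>. (\<lambda>e. \<phi> ` e) ` \<omega>) \<in> measurable config_space config_space"
proof (rule measurable_config_space)
  fix \<omega> assume "\<omega> \<in> space config_space"
  then show "(\<lambda>e. \<phi> ` e) ` \<omega> \<subseteq> slab_edges"
    by (auto simp: space_config_space slab_aut_edge[OF \<phi>])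
next
  fix e
  have "e \<in> (\<lambda>e. \<phi> ` e) ` \<omega> \<longleftrightarrow> inv \<phi> ` e \<in> \<omega>" for \<omega>
  proof
    assume "e \<in> (\<lambda>e. \<phi> ` e) ` \<omega>"
    then show "inv \<phi> ` e \<in> \<omega>" using slab_aut_bij[OF \<phi>] by (auto simp: bij_is_inj)
  next
    assume "inv \<phi> ` e \<in> \<omega>"
    then show "e \<in> (\<lambda>e. \<phi> ` e) ` \<omega>"
      by (rule rev_image_eqI) (use slab_aut_bij[OF \<phi>] in \<open>simp add: bij_is_surj image_f_inv_f\<close>)
  qed
  then show "{\<omega> \<in> space config_space. e \<in> (\<lambda>e. \<phi> ` e) ` \<omega>} \<in> sets config_space"
    using sets_config_space_edge[of "inv \<phi> ` e"] by (simp only:)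
qed

theorem theorem1p1:
  shows "\<exists>P. invariant_bond_percolation P \<and>
           (AE \<omega> in P. infinite {C \<in> clusters \<omega>. robust \<omega> C})"
proof (intro exI conjI)
  let ?P = "distr env config_space hierarchy"
  interpret prob_space env by (rule prob_space_env)
  \<comment> \<open>Moving the configuration by \<open>\<phi>\<close> amounts to letting
    \<open>inv \<phi>\<close> act on the environment, whose law is unchanged.\<close>
  have "distr ?P config_space (\<lambda>\<omega>. (\<lambda>e. \<phi> ` e) ` \<omega>) = ?P" if \<phi>: "slab_aut \<phi>" for \<phi>
  proof -
    note act = measurable_act[OF slab_aut_inv[OF \<phi>]]
    have "distr ?P config_space (\<lambda>\<omega>. (\<lambda>e. \<phi> ` e) ` \<omega>)
        = distr env config_space (hierarchy \<circ> act (inv \<phi>))"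
      unfolding distr_distr[OF measurable_image_config[OF \<phi>] measurable_hierarchy]
      by (simp add: comp_def image_hierarchy[OF \<phi>])
    also have "\<dots> = distr (distr env env (act (inv \<phi>))) config_space hierarchy"
      by (rule distr_distr[OF measurable_hierarchy act, symmetric])
    also have "\<dots> = ?P" unfolding env_invariant[OF slab_aut_inv[OF \<phi>]] ..
    finally show ?thesis .
  qed
  then show "invariant_bond_percolation ?P"
    unfolding invariant_bond_percolation_def using prob_space_distr[OF measurable_hierarchy] by simp
  \<comment> \<open>The detour through \<open>rich\<close> supplies a measurable event, which the
    transfer of an almost sure statement to the image measure requires.\<close>
  have "AE \<omega> in ?P. rich \<omega>"
    unfolding AE_distr_iff[OF measurable_hierarchy measurable_rich]
    using env_aut by (intro AE_I2 rich_hierarchy)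
  moreover have "AE \<omega> in ?P. \<omega> \<subseteq> slab_edges"
    by (rule AE_I2) (simp add: space_config_space)
  ultimately show "AE \<omega> in ?P. infinite {C \<in> clusters \<omega>. robust \<omega> C}"
    by eventually_elim (rule rich_robust_clusters)
qed

end
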